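(* Let $f:[0,4]\to(-\infty,\infty]$ be a function finite and continuous on $(0,4]$ with $f(0)=\lim_{t\to0^+}f(t)$ and with the fourth derivative $f^{(4)}$ existing and convex on $(0,4)$. Then (i) the potential $p_f(\cdot,\overline\omega_{54})$ attains its absolute minimum over $S^5$ at every point of $\overline\omega_{72}$; (ii) the potential $p_f(\cdot,\overline\omega_{72})$ attains its absolute minimum over $S^5$ at every point of $\overline\omega_{54}$. If $f^{(4)}$ is strictly convex on $(0,4)$, then $p_f(\cdot,\overline\omega_{54})$ has no points of absolute minimum on $S^5$ outside $\overline\omega_{72}$, and $p_f(\cdot,\overline\omega_{72})$ has no points of absolute minimum on $S^5$ outside $\overline\omega_{54}$.
   Context: $S^5$ is the unit sphere in $\mathbb R^6$; for finite $\omega=\{\mathbf x_1,\dots,\mathbf x_N\}\subset S^5$, $p_f(\mathbf x,\omega)=\sum_{i=1}^N f(|\mathbf x-\mathbf x_i|^2)$. The Schläffi configuration $\overline\omega_{27}\subset S^5$ consists of: the point $(0,0,0,0,0,1)$; the ten points whose sixth coordinate is $-1/2$, one of the first five coordinates is $\pm\sqrt3/2$ and the other four are $0$; and the sixteen points whose sixth coordinate is $1/4$ and whose first five coordinates are each $\pm\sqrt3/4$ with an even number of minus signs. Let $\overline\omega_{54}=\overline\omega_{27}\cup(-\overline\omega_{27})$. Let $\overline\omega_{72}\subset S^5$ consist of the 40 vectors having two of the first five coordinates equal to $\pm1/\sqrt2$ and the remaining four coordinates equal to $0$, together with the 32 vectors $\big(\pm\frac1{2\sqrt2},\pm\frac1{2\sqrt2},\pm\frac1{2\sqrt2},\pm\frac1{2\sqrt2},\pm\frac1{2\sqrt2},\pm\frac{\sqrt3}{2\sqrt2}\big)$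 with an odd number of minus signs. *)

theory Defs
  imports "HOL-Analysis.Analysis"
begin

abbreviation S5 :: "(real ^ 6) set" where
  "S5 \<equiv> sphere 0 1"

(* In the index type 6 the numeral 6 denotes the same element as 0; the indices
   i \<noteq> 6, namely 1, ..., 5, are the first five coordinates. *)

definition omega27 :: "(real ^ 6) set" where
  "omega27 =
     {axis 6 1}
   \<union> {x. x $ 6 = - 1 / 2 \<and>
          (\<exists>i. i \<noteq> 6 \<and> \<bar>x $ i\<bar> = sqrt 3 / 2 \<and> (\<forall>j. j \<noteq> 6 \<and> j \<noteq> i \<longrightarrow> x $ j = 0))}
   \<union> {x. x $ 6 = 1 / 4 \<and> (\<forall>i. i \<noteq> 6 \<longrightarrow> \<bar>x $ i\<bar> = sqrt 3 / 4) \<and>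
          even (card {i. i \<noteq> 6 \<and> x $ i < 0})}"

definition omega54 :: "(real ^ 6) set" where
  "omega54 = omega27 \<union> uminus ` omega27"

definition omega72 :: "(real ^ 6) set" where
  "omega72 =
     {x. \<exists>i j. i \<noteq> 6 \<and> j \<noteq> 6 \<and> i \<noteq> j \<and>
          \<bar>x $ i\<bar> = 1 / sqrt 2 \<and> \<bar>x $ j\<bar> = 1 / sqrt 2 \<and>
          (\<forall>k. k \<noteq> i \<and> k \<noteq> j \<longrightarrow> x $ k = 0)}
   \<union> {x. (\<forall>i. i \<noteq> 6 \<longrightarrow> \<bar>x $ i\<bar> = 1 / (2 * sqrt 2)) \<and> \<bar>x $ 6\<bar> = sqrt 3 / (2 * sqrt 2) \<and>
          odd (card {i. x $ i < 0})}"

definition potential :: "(real \<Rightarrow> ereal) \<Rightarrow> (real ^ 6) set \<Rightarrow> real ^ 6 \<Rightarrow> ereal" where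
  "potential f \<omega> x = (\<Sum>y\<in>\<omega>. f ((norm (x - y))\<^sup>2))"

definition abs_min_points :: "(real ^ 6 \<Rightarrow> ereal) \<Rightarrow> (real ^ 6) set" where
  "abs_min_points p = {x \<in> S5. \<forall>y\<in>S5. p x \<le> p y}"

definition strictly_convex_on :: "real set \<Rightarrow> (real \<Rightarrow> real) \<Rightarrow> bool" where
  "strictly_convex_on S g \<longleftrightarrow> convex S \<and>
     (\<forall>x\<in>S. \<forall>y\<in>S. \<forall>t. x \<noteq> y \<and> 0 < t \<and> t < 1 \<longrightarrow>
        g ((1 - t) * x + t * y) < (1 - t) * g x + t * g y)"

(* The real-valued function to be differentiated; it agrees with f wherever f is finite. *)
abbreviation finite_part :: "(real \<Rightarrow> ereal) \<Rightarrow> real \<Rightarrow> real" where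
  "finite_part f \<equiv> \<lambda>t. real_of_ereal (f t)"

(* deriv is total, so existence of the n-th derivative is stated separately. *)
definition times_differentiable_on :: "nat \<Rightarrow> (real \<Rightarrow> real) \<Rightarrow> real set \<Rightarrow> bool" where
  "times_differentiable_on n g S \<longleftrightarrow>
     (\<forall>k<n. \<forall>t\<in>S. (deriv ^^ k) g differentiable (at t))"

end

theory Submission
  imports Defs "HOL-Computational_Algebra.Polynomial"
begin

text \<open>
  All inner products between a point of one configuration and a point of the other lie in
  \<open>{0, b, - b}\<close> with \<open>b = sqrt 6 / 4\<close>, so the squared distances take only the values 2 and
  \<open>2 \<plusminus> 2 b\<close>. Let P be the polynomial of degree at most 5 that agrees with f to first
  order at these three values. Convexity of the fourth derivative gives P \<open>\<le>\<close> f on the whole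
  interval. Both configurations are antipodal spherical 5-designs, so the sum of P over the
  squared distances to the configuration is constant on the sphere; it bounds the potential from
  below, with equality at the points all of whose inner products lie in \<open>{0, b, - b}\<close>.
  In the strict case equality forces every inner product into \<open>{0, b, - b, 1, - 1}\<close>; the second
  and fourth moments exclude \<open>\<plusminus>1\<close>, and the remaining points are found by solving
  for their coordinates.
\<close>

subsection \<open>Hermite interpolation with convex fourth derivative\<close>

text \<open>Disjointness from \<open>Z\<close> matters for counting: where \<open>e\<close> has a
  double zero, \<open>e'\<close> vanishes as well, and such points of \<open>Z\<close> can then be
  added to \<open>W\<close> without being counted twice.\<close>

lemma Rolle_zeros:
  fixes e e' :: "real \<Rightarrow> real"
  assumes der: "\<And>t. t \<in> {l<..<u} \<Longrightarrow> (e has_real_derivative e' t) (at t)"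
    and "finite Z" "Z \<subseteq> {l<..<u}" "\<And>z. z \<in> Z \<Longrightarrow> e z = 0"
  shows "\<exists>W\<subseteq>{l<..<u}. finite W \<and> Suc (card W) \<ge> card Z \<and> W \<inter> Z = {} \<and> (\<forall>w\<in>W. e' w = 0)"
proof -
  \<comment> \<open>The induction adds the largest point last. The extra clause that each
    \<open>w\<close> lies below a point of \<open>Z\<close> keeps the zero found in the last gap out
    of the old \<open>W\<close>, and the new maximum too.\<close>
  have "\<exists>W\<subseteq>{l<..<u}. finite W \<and> Suc (card W) \<ge> card Z \<and> W \<inter> Z = {} \<and>
      (\<forall>w\<in>W. e' w = 0 \<and> (\<exists>z\<in>Z. w < z))"
    using assms(2-4)
  proof (induction Z rule: finite_linorder_max_induct)
    case empty
    show ?case by (rule exI[of _ "{}"]) auto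
  next
    case (insert m Z)
    then obtain W where W: "W \<subseteq> {l<..<u}" "finite W" "Suc (card W) \<ge> card Z" "W \<inter> Z = {}"
      "\<And>w. w \<in> W \<Longrightarrow> e' w = 0" "\<And>w. w \<in> W \<Longrightarrow> \<exists>z\<in>Z. w < z"
      by auto
    show ?case
    proof (cases "Z = {}")
      case True
      then show ?thesis by (intro exI[of _ "{}"]) auto
    next
      case False
      define k where "k = Max Z"
      have k: "k \<in> Z" "\<And>z. z \<in> Z \<Longrightarrow> z \<le> k"
        using False insert.hyps(1) by (auto simp: k_def)
      have km: "k < m" "l < k" "m < u" using insert k(1) by auto
      have "\<exists>w>k. w < m \<and> e' w = 0"
      proof -
        have "continuous_on {k..m} e"
          using km DERIV_isCont[OF der] by (intro continuous_at_imp_continuous_on) auto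
        moreover have "e differentiable at x" if "k < x" "x < m" for x
          using der[of x] that km by (auto simp: real_differentiable_def)
        ultimately obtain w where w: "k < w" "w < m" "DERIV e w :> 0"
          using Rolle[of k m e] km(1) insert.prems(2) k(1) by force
        then show ?thesis
          using DERIV_unique[OF w(3) der[of w]] km by auto
      qed
      then obtain w where w: "k < w" "w < m" "e' w = 0" by blast
      have wW: "w \<notin> W" using W(6) k(2) w(1) by force
      have wZ: "w \<notin> Z" using k(2) w(1) by force
      have mW: "m \<notin> W" using W(6) insert.hyps(2) by force
      have mZ: "m \<notin> Z" using insert.hyps(2) by blast
      show ?thesis
        by (rule exI[of _ "insert w W"])
          (use W w wW wZ mW mZ km insert.hyps in \<open>auto simp: card_insert_if\<close>)
    qed
  qed
  then show ?thesis by blast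
qed

section \<open>Nodal polynomial and existence of the Hermite interpolant\<close>

definition double_nodes :: "real set \<Rightarrow> real poly" where
  "double_nodes N = (\<Prod>z\<in>N. [:- z, 1:] ^ 2)"

lemma poly_double_nodes_eq_0_iff:
  "finite N \<Longrightarrow> poly (double_nodes N) t = 0 \<longleftrightarrow> t \<in> N"
  by (auto simp: double_nodes_def poly_prod)

lemma poly_pderiv_double_nodes:
  assumes "finite N" "z \<in> N"
  shows "poly (pderiv (double_nodes N)) z = 0"
proof -
  have "double_nodes N = [:- z, 1:] ^ 2 * double_nodes (N - {z})"
    using assms by (simp add: double_nodes_def prod.remove)
  then show ?thesis
    by (simp only: pderiv_mult poly_add poly_mult numeral_2_eq_2 pderiv_power_Suc) simp
qed

lemma degree_double_nodes: "finite N \<Longrightarrow> degree (double_nodes N) = 2 * card N"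
  by (simp add: double_nodes_def degree_prod_eq_sum_degree degree_power_eq sum_distrib_left)

lemma lead_coeff_double_nodes: "lead_coeff (double_nodes N) = 1"
  by (simp add: double_nodes_def lead_coeff_prod lead_coeff_power)

text \<open>Newton's scheme, one node at a time. The alternative \<open>P = 0\<close> covers the
  empty set of nodes, where no degree is below 0.\<close>

lemma Hermite_interpolation_exists:
  fixes v d :: "real \<Rightarrow> real"
  assumes "finite N"
  shows "\<exists>P. (P = 0 \<or> degree P < 2 * card N) \<and>
    (\<forall>z\<in>N. poly P z = v z \<and> poly (pderiv P) z = d z)"
  using assms
proof (induction N)
  case empty
  show ?case by (rule exI[of _ 0]) auto
next
  case (insert x N)
  then obtain P where P: "P = 0 \<or> degree P < 2 * card N"
    "\<And>z. z \<in> N \<Longrightarrow> poly P z = v z \<and> poly (pderiv P) z = d z" by auto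
  define W where "W = double_nodes N"
  have Wx: "poly W x \<noteq> 0"
    using insert by (simp add: W_def poly_double_nodes_eq_0_iff)
  define \<alpha> where "\<alpha> = (v x - poly P x) / poly W x"
  define \<beta> where "\<beta> = (d x - poly (pderiv P) x - poly (pderiv W) x * \<alpha>) / poly W x"
  \<comment> \<open>The correction is \<open>W\<close> times
    \<open>\<alpha> + \<beta> * (t - x)\<close>. As \<open>W\<close> has double zeros at the old
    nodes, nothing changes there; \<alpha> adjusts the value at \<open>x\<close> and \<beta> the
    slope.\<close>
  define Q where "Q = P + W * [:\<alpha> - \<beta> * x, \<beta>:]"
  have dW: "degree W = 2 * card N"
    using insert by (simp add: W_def degree_double_nodes)
  have "degree (W * [:\<alpha> - \<beta> * x, \<beta>:]) \<le> 2 * card N + 1"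
    by (rule order_trans[OF degree_mult_le]) (use dW in simp)
  then have "degree Q \<le> 2 * card N + 1"
    unfolding Q_def by (intro degree_add_le) (use P(1) in auto)
  moreover have "poly Q z = v z \<and> poly (pderiv Q) z = d z" if "z \<in> insert x N" for z
  proof (cases "z = x")
    case True
    have "poly Q x = poly P x + poly W x * \<alpha>"
      "poly (pderiv Q) x = poly (pderiv P) x + (poly W x * \<beta> + poly (pderiv W) x * \<alpha>)"
      by (simp_all only: Q_def pderiv_add pderiv_mult pderiv_pCons poly_add poly_mult)
        (simp_all add: algebra_simps)
    then show ?thesis using Wx True
      by (simp add: \<alpha>_def \<beta>_def)
  next
    case False
    then have z: "z \<in> N" using that by simp
    then have "poly W z = 0" "poly (pderiv W) z = 0"
      using insert.hyps by (simp_all add: W_def poly_double_nodes_eq_0_iff poly_pderiv_double_nodes)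
    then show ?thesis using P(2)[OF z]
      by (simp only: Q_def pderiv_add pderiv_mult poly_add poly_mult) simp
  qed
  ultimately show ?case
    using insert.hyps by (intro exI[of _ Q]) auto
qed

section \<open>Interpolation error and the sign given by convexity\<close>

lemma poly_eq_quadratic:
  assumes "degree (Q :: real poly) \<le> 2"
  shows "poly Q x = coeff Q 0 + coeff Q 1 * x + coeff Q 2 * x ^ 2"
proof -
  have "poly Q x = (\<Sum>i\<le>2. coeff Q i * x ^ i)"
    unfolding poly_altdef
    by (rule sum.mono_neutral_left) (use assms in \<open>auto simp: coeff_eq_0 not_le\<close>)
  then show ?thesis by (simp add: numeral_2_eq_2)
qed

text \<open>For a quadratic the gap between chord and graph sees only the leading coefficient; this
  turns convexity of a fourth derivative into the sign of a degree 6 coefficient.\<close>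

lemma quadratic_chord_defect:
  assumes "degree (Q :: real poly) \<le> 2"
  shows "(1 - t) * poly Q x + t * poly Q y - poly Q ((1 - t) * x + t * y) =
    coeff Q 2 * (t * (1 - t) * (y - x) ^ 2)"
  unfolding poly_eq_quadratic[OF assms] by (simp add: algebra_simps power2_eq_square)

lemma between_convex_comb:
  fixes a b c :: real
  assumes "a < b" "b < c"
  obtains t where "0 < t" "t < 1" "b = (1 - t) * a + t * c"
proof
  show "0 < (b - a) / (c - a)" "(b - a) / (c - a) < 1"
    using assms by (auto simp: divide_simps)
  have "(b - a) / (c - a) * (c - a) = b - a" using assms by simp
  then show "b = (1 - (b - a) / (c - a)) * a + (b - a) / (c - a) * c"
    unfolding left_diff_distrib right_diff_distrib mult_1 by linarith
qed

lemma three_elements_increasing: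
  fixes Z :: "real set"
  assumes "finite Z" "card Z \<ge> 3"
  obtains a b c where "a \<in> Z" "b \<in> Z" "c \<in> Z" "a < b" "b < c"
proof -
  have "Z \<noteq> {}" using assms by auto
  then have "Min Z \<in> Z" "Max Z \<in> Z" using assms by auto
  moreover have "card (Z - {Min Z, Max Z}) > 0"
    using diff_card_le_card_Diff[of "{Min Z, Max Z}" Z] assms card_insert_le_m1[of 2 "{Max Z}" "Min Z"]
    by simp
  then obtain b where "b \<in> Z" "b \<noteq> Min Z" "b \<noteq> Max Z"
    by (metis Diff_iff card_gt_0_iff ex_in_conv insertCI)
  ultimately show ?thesis
    using that[of "Min Z" b "Max Z"] assms by (simp add: order_less_le)
qed

(* The remainder g - P is compared with the multiple c of the nodal polynomial that makes
   the difference vanish also at t; Rolle then yields three zeros of its fourth derivative,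
   whose second divided difference has the sign of c. *)
lemma Hermite_remainder:
  fixes D :: "nat \<Rightarrow> real \<Rightarrow> real"
  assumes der: "\<And>k s. k < 4 \<Longrightarrow> s \<in> {l<..<u} \<Longrightarrow> (D k has_real_derivative D (Suc k) s) (at s)"
    and N: "N \<subseteq> {l<..<u}" "card N = 3"
    and P: "degree P \<le> 5" "\<And>z. z \<in> N \<Longrightarrow> poly P z = D 0 z"
      "\<And>z. z \<in> N \<Longrightarrow> poly (pderiv P) z = D 1 z"
    and t: "t \<in> {l<..<u}" "t \<notin> N"
  obtains c x y \<tau> where "D 0 t = poly P t + c * poly (double_nodes N) t"
    "x \<in> {l<..<u}" "y \<in> {l<..<u}" "x < y" "0 < \<tau>" "\<tau> < 1"
    "(1 - \<tau>) * D 4 x + \<tau> * D 4 y - D 4 ((1 - \<tau>) * x + \<tau> * y) = 360 * c * (\<tau> * (1 - \<tau>) * (y - x) ^ 2)"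
proof -
  have fN: "finite N" using N(2) by (metis card.infinite zero_neq_numeral)
  define W where "W = double_nodes N"
  have Wt: "poly W t \<noteq> 0" using t fN by (simp add: W_def poly_double_nodes_eq_0_iff)
  define c where "c = (D 0 t - poly P t) / poly W t"
  define R where "R = P + smult c W"
  define e where "e k s = D k s - poly ((pderiv ^^ k) R) s" for k s
  have der_e: "(e k has_real_derivative e (Suc k) s) (at s)"
    if "k < 4" "s \<in> {l<..<u}" for k s
    unfolding e_def using der[OF that] by (auto intro!: derivative_eq_intros poly_DERIV)
  have e0: "e 0 z = 0" if "z \<in> insert t N" for z
    using that P(2) fN Wt
    by (auto simp: e_def R_def c_def) (simp_all add: W_def poly_double_nodes_eq_0_iff)
  have e1: "e 1 z = 0" if "z \<in> N" for z
    using that P(3) fN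
    by (simp add: e_def R_def pderiv_add pderiv_smult W_def poly_pderiv_double_nodes)
  obtain Z1 where Z1: "Z1 \<subseteq> {l<..<u}" "finite Z1" "card (insert t N) \<le> Suc (card Z1)"
      "Z1 \<inter> insert t N = {}" "\<forall>w\<in>Z1. e 1 w = 0"
    using Rolle_zeros[of l u "e 0" "e 1" "insert t N"] der_e[of 0] e0 N(1) t(1) fN by auto
  \<comment> \<open>Count of zeros: at least four for \<open>e 0\<close>, hence three for
    \<open>e 1\<close> off the nodes; the three nodes are double zeros and raise this to six. Each
    further use of Rolle loses one: 5, 4, 3.\<close>
  have "card (Z1 \<union> N) = card Z1 + card N"
    using Z1 fN by (intro card_Un_disjoint) auto
  then have c1: "card (Z1 \<union> N) \<ge> 6"
    using Z1(3) fN N(2) t(2) by simp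
  obtain Z2 where Z2: "Z2 \<subseteq> {l<..<u}" "finite Z2" "card (Z1 \<union> N) \<le> Suc (card Z2)"
      "\<forall>w\<in>Z2. e 2 w = 0"
  proof -
    have "\<And>z. z \<in> Z1 \<union> N \<Longrightarrow> e 1 z = 0" using e1 Z1(5) by auto
    then show ?thesis
      using that Rolle_zeros[of l u "e 1" "e 2" "Z1 \<union> N"] der_e[of 1] Z1(1,2) N(1) fN
      by (auto simp: eval_nat_numeral)
  qed
  obtain Z3 where Z3: "Z3 \<subseteq> {l<..<u}" "finite Z3" "card Z2 \<le> Suc (card Z3)"
      "\<forall>w\<in>Z3. e 3 w = 0"
    using Rolle_zeros[of l u "e 2" "e 3" Z2] der_e[of 2] Z2 by (auto simp: eval_nat_numeral)
  obtain Z4 where Z4: "Z4 \<subseteq> {l<..<u}" "finite Z4" "card Z3 \<le> Suc (card Z4)"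
      "\<forall>w\<in>Z4. e 4 w = 0"
    using Rolle_zeros[of l u "e 3" "e 4" Z3] der_e[of 3] Z3 by (auto simp: eval_nat_numeral)
  have "card Z4 \<ge> 3" using c1 Z2(3) Z3(3) Z4(3) by linarith
  then obtain x m y where xmy: "x \<in> Z4" "m \<in> Z4" "y \<in> Z4" "x < m" "m < y"
    using three_elements_increasing[OF Z4(2)] by metis
  obtain \<tau> where \<tau>: "0 < \<tau>" "\<tau> < 1" "m = (1 - \<tau>) * x + \<tau> * y"
    using between_convex_comb[OF xmy(4,5)] by blast
  define Q where "Q = (pderiv ^^ 4) R"
  have dW: "degree W = 6" using fN N(2) by (simp add: W_def degree_double_nodes)
  have "coeff W 6 = 1" using lead_coeff_double_nodes[of N] dW by (simp add: W_def)
  then have R6: "coeff R 6 = c"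
    using P(1) by (simp add: R_def coeff_eq_0)
  have "degree R \<le> 6"
    unfolding R_def by (intro degree_add_le) (use P(1) dW in \<open>auto intro: order_trans[OF degree_smult_le]\<close>)
  then have dQ: "degree Q \<le> 2"
    by (intro degree_le) (auto simp: Q_def coeff_higher_pderiv coeff_eq_0)
  \<comment> \<open>The degree 6 term of \<open>R\<close> is \<open>c\<close> times that of the
    monic nodal polynomial, and four derivatives multiply it by
    \<open>6 * 5 * 4 * 3 = 360\<close>.\<close>
  have Q2: "coeff Q 2 = 360 * c"
    by (simp add: Q_def coeff_higher_pderiv R6) (simp add: eval_nat_numeral pochhammer_rec)
  \<comment> \<open>At the three zeros of \<open>e 4\<close> the function \<open>D 4\<close> takes
    the values of the quadratic \<open>Q\<close>, so its chord defect there is that of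
    \<open>Q\<close>.\<close>
  have "D 4 z = poly Q z" if "z \<in> Z4" for z
    using Z4(4) that by (auto simp: e_def Q_def)
  then have "(1 - \<tau>) * D 4 x + \<tau> * D 4 y - D 4 ((1 - \<tau>) * x + \<tau> * y) =
      360 * c * (\<tau> * (1 - \<tau>) * (y - x) ^ 2)"
    using quadratic_chord_defect[OF dQ, of \<tau> x y] xmy \<tau>(3) by (simp add: Q2)
  moreover have "D 0 t = poly P t + c * poly (double_nodes N) t"
    using Wt by (simp add: c_def W_def)
  moreover have "x \<in> {l<..<u}" "y \<in> {l<..<u}" "x < y" using xmy Z4(1) by auto
  ultimately show ?thesis using that \<tau>(1,2) by blast
qed

lemma poly_double_nodes_nonneg: "poly (double_nodes N) t \<ge> 0"
  by (simp add: double_nodes_def poly_prod prod_nonneg)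

text \<open>The chord defect of \<open>D 4\<close> is a positive multiple of the coefficient
  \<open>c\<close> of the remainder, so convexity gives \<open>c \<ge> 0\<close> and strict
  convexity \<open>c > 0\<close>. The nodal polynomial is a product of squares and vanishes only on
  \<open>N\<close>.\<close>

lemma Hermite_lower_bound:
  fixes D :: "nat \<Rightarrow> real \<Rightarrow> real"
  assumes der: "\<And>k s. k < 4 \<Longrightarrow> s \<in> {l<..<u} \<Longrightarrow> (D k has_real_derivative D (Suc k) s) (at s)"
    and N: "N \<subseteq> {l<..<u}" "card N = 3"
    and P: "degree P \<le> 5" "\<And>z. z \<in> N \<Longrightarrow> poly P z = D 0 z"
      "\<And>z. z \<in> N \<Longrightarrow> poly (pderiv P) z = D 1 z"
    and t: "t \<in> {l<..<u}"
  shows "convex_on {l<..<u} (D 4) \<Longrightarrow> poly P t \<le> D 0 t"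
    and "strictly_convex_on {l<..<u} (D 4) \<Longrightarrow> t \<notin> N \<Longrightarrow> poly P t < D 0 t"
proof -
  have fN: "finite N" using N(2) by (metis card.infinite zero_neq_numeral)
  show "poly P t \<le> D 0 t" if conv: "convex_on {l<..<u} (D 4)"
  proof (cases "t \<in> N")
    case True
    then show ?thesis using P(2) by simp
  next
    case False
    from Hermite_remainder[OF assms False]
    obtain c x y \<tau> where c: "D 0 t = poly P t + c * poly (double_nodes N) t"
      "x \<in> {l<..<u}" "y \<in> {l<..<u}" "x < y" "0 < \<tau>" "\<tau> < 1"
      "(1 - \<tau>) * D 4 x + \<tau> * D 4 y - D 4 ((1 - \<tau>) * x + \<tau> * y) = 360 * c * (\<tau> * (1 - \<tau>) * (y - x) ^ 2)" .
    have "0 \<le> 360 * c * (\<tau> * (1 - \<tau>) * (y - x) ^ 2)"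
      using convex_onD[OF conv, of \<tau> x y] c(2-6) unfolding c(7)[symmetric] by simp
    moreover have "\<tau> * (1 - \<tau>) * (y - x) ^ 2 > 0" using c by simp
    ultimately have "c \<ge> 0" by (simp add: zero_le_mult_iff)
    then show ?thesis using c(1) poly_double_nodes_nonneg[of N t] by simp
  qed
  show "poly P t < D 0 t" if conv: "strictly_convex_on {l<..<u} (D 4)" and "t \<notin> N"
  proof -
    from Hermite_remainder[OF assms \<open>t \<notin> N\<close>]
    obtain c x y \<tau> where c: "D 0 t = poly P t + c * poly (double_nodes N) t"
      "x \<in> {l<..<u}" "y \<in> {l<..<u}" "x < y" "0 < \<tau>" "\<tau> < 1"
      "(1 - \<tau>) * D 4 x + \<tau> * D 4 y - D 4 ((1 - \<tau>) * x + \<tau> * y) = 360 * c * (\<tau> * (1 - \<tau>) * (y - x) ^ 2)" .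
    have "D 4 ((1 - \<tau>) * x + \<tau> * y) < (1 - \<tau>) * D 4 x + \<tau> * D 4 y"
      using conv c(2-6) unfolding strictly_convex_on_def by fastforce
    then have "0 < 360 * c * (\<tau> * (1 - \<tau>) * (y - x) ^ 2)"
      using c(7) by linarith
    moreover have "\<tau> * (1 - \<tau>) * (y - x) ^ 2 > 0" using c by simp
    ultimately have "c > 0" by (simp add: zero_less_mult_iff)
    moreover have "poly (double_nodes N) t > 0"
      using poly_double_nodes_nonneg[of N t] poly_double_nodes_eq_0_iff[OF fN] \<open>t \<notin> N\<close>
      by (simp add: order_less_le)
    ultimately show ?thesis using c(1) by simp
  qed
qed

subsection \<open>Potentials of antipodal 5-designs\<close>

lemma sphere_dist_inner:
  fixes x y :: "'a :: real_inner"
  assumes "x \<in> sphere 0 1" "y \<in> sphere 0 1"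
  shows "(norm (x - y))\<^sup>2 = 2 - 2 * (x \<bullet> y)" and "\<bar>x \<bullet> y\<bar> \<le> 1"
proof -
  have xy: "norm x = 1" "norm y = 1" using assms by auto
  then show "(norm (x - y))\<^sup>2 = 2 - 2 * (x \<bullet> y)"
    using dot_norm_neg[of x y] by simp
  show "\<bar>x \<bullet> y\<bar> \<le> 1" using Cauchy_Schwarz_ineq2[of x y] xy by simp
qed

(* The inner products 0, sqrt 6 / 4, - sqrt 6 / 4 that occur between the two configurations. *)
definition critical_inner :: "real \<Rightarrow> bool" where
  "critical_inner t \<longleftrightarrow> t = 0 \<or> t\<^sup>2 = 3 / 8"

text \<open>\<open>1 / 6\<close> and \<open>1 / 16 = 3 / (6 * 8)\<close> are the averages over the
  sphere of the second and fourth powers of an inner product with a fixed unit vector. With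
  antipodality, which kills odd moments, they express the 5-design property.\<close>

locale antipodal_design =
  fixes \<omega> :: "(real ^ 6) set"
  assumes finite: "finite \<omega>"
    and sphere: "\<omega> \<subseteq> S5"
    and antipodal: "y \<in> \<omega> \<Longrightarrow> - y \<in> \<omega>"
    and moment2: "x \<in> S5 \<Longrightarrow> (\<Sum>y\<in>\<omega>. (x \<bullet> y) ^ 2) = card \<omega> / 6"
    and moment4: "x \<in> S5 \<Longrightarrow> (\<Sum>y\<in>\<omega>. (x \<bullet> y) ^ 4) = card \<omega> / 16"
begin

lemma sum_uminus: "(\<Sum>y\<in>\<omega>. g (- y)) = (\<Sum>y\<in>\<omega>. g y)"
  by (rule sum.reindex_bij_witness[where i = uminus and j = uminus]) (auto intro: antipodal)

lemma odd_moment: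
  assumes "odd k"
  shows "(\<Sum>y\<in>\<omega>. (x \<bullet> y) ^ k) = 0"
proof -
  have "(\<Sum>y\<in>\<omega>. (x \<bullet> y) ^ k) = (\<Sum>y\<in>\<omega>. (x \<bullet> - y) ^ k)"
    by (rule sum_uminus[symmetric])
  also have "\<dots> = - (\<Sum>y\<in>\<omega>. (x \<bullet> y) ^ k)"
    using assms by (simp add: sum_negf)
  finally show ?thesis by simp
qed

lemma moment_eq:
  assumes "x \<in> S5" "x' \<in> S5" "k \<le> 5"
  shows "(\<Sum>y\<in>\<omega>. (x \<bullet> y) ^ k) = (\<Sum>y\<in>\<omega>. (x' \<bullet> y) ^ k)"
proof (cases "odd k")
  case True
  then show ?thesis by (simp add: odd_moment)
next
  case False
  with assms(3) have "k = 0 \<or> k = 2 \<or> k = 4" by presburger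
  then show ?thesis using moment2[of x] moment2[of x'] moment4[of x] moment4[of x'] assms(1,2) by auto
qed

text \<open>Substituting \<open>2 - 2 * t\<close> for the squared distance gives a polynomial of
  degree at most 5 in the inner product; its sum is a combination of the moments up to order 5, none
  of which depends on the point.\<close>

lemma sum_poly_eq:
  assumes "x \<in> S5" "x' \<in> S5" "degree P \<le> 5"
  shows "(\<Sum>y\<in>\<omega>. poly P (2 - 2 * (x \<bullet> y))) = (\<Sum>y\<in>\<omega>. poly P (2 - 2 * (x' \<bullet> y)))"
proof -
  define Q where "Q = pcompose P [:2, - 2:]"
  have "degree Q \<le> 5" using assms(3) by (simp add: Q_def degree_pcompose)
  then have Q: "poly Q t = (\<Sum>k\<le>5. coeff Q k * t ^ k)" for t
    unfolding poly_altdef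
    by (intro sum.mono_neutral_left) (auto simp: coeff_eq_0 not_le)
  have *: "(\<Sum>y\<in>\<omega>. poly P (2 - 2 * (z \<bullet> y))) = (\<Sum>k\<le>5. coeff Q k * (\<Sum>y\<in>\<omega>. (z \<bullet> y) ^ k))" for z
  proof -
    have "poly P (2 - 2 * t) = poly Q t" for t
      by (simp add: Q_def poly_pcompose mult.commute)
    then have "(\<Sum>y\<in>\<omega>. poly P (2 - 2 * (z \<bullet> y))) = (\<Sum>y\<in>\<omega>. \<Sum>k\<le>5. coeff Q k * (z \<bullet> y) ^ k)"
      by (simp add: Q)
    also have "\<dots> = (\<Sum>k\<le>5. coeff Q k * (\<Sum>y\<in>\<omega>. (z \<bullet> y) ^ k))"
      by (subst sum.swap) (simp add: sum_distrib_left)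
    finally show ?thesis .
  qed
  show ?thesis unfolding * using moment_eq[OF assms(1,2)] by simp
qed

(* The second and fourth moments make the sum of t^2 (t^2 - 3/8) vanish. *)
lemma critical_inner_if_extremal:
  assumes "x \<in> S5" and all: "\<And>y. y \<in> \<omega> \<Longrightarrow> critical_inner (x \<bullet> y) \<or> \<bar>x \<bullet> y\<bar> = 1"
    and "y \<in> \<omega>"
  shows "critical_inner (x \<bullet> y)"
proof -
  let ?g = "\<lambda>t::real. t ^ 4 - 3 / 8 * t ^ 2"
  have g: "?g (x \<bullet> z) = 0 \<and> critical_inner (x \<bullet> z) \<or> ?g (x \<bullet> z) > 0" if "z \<in> \<omega>" for z
  proof -
    have *: "t ^ 4 = (t\<^sup>2)\<^sup>2" for t :: real by simp
    show ?thesis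
    proof (cases "critical_inner (x \<bullet> z)")
      case True
      then show ?thesis unfolding critical_inner_def * by (auto simp: power2_eq_square)
    next
      case False
      then have "(x \<bullet> z)\<^sup>2 = 1" using all[OF that] by (metis one_power2 power2_abs)
      then show ?thesis unfolding * by simp
    qed
  qed
  \<comment> \<open>Here \<open>1 / 16 - 3 / 8 * (1 / 6) = 0\<close>. The summand is zero at
    critical values and \<open>5 / 8\<close> at inner products 1 and -1, so the latter cannot
    occur.\<close>
  have "(\<Sum>z\<in>\<omega>. ?g (x \<bullet> z)) = 0"
    unfolding sum_subtractf sum_distrib_left[symmetric]
    using moment2[OF assms(1)] moment4[OF assms(1)] by simp
  moreover have "\<forall>z\<in>\<omega>. ?g (x \<bullet> z) \<ge> 0" using g by force
  ultimately have "\<forall>z\<in>\<omega>. ?g (x \<bullet> z) = 0"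
    using finite by (subst (asm) sum_nonneg_eq_0_iff) auto
  then show ?thesis using g[OF assms(3)] assms(3) by force
qed

end

(* The squared distances 2 - 2 t for the critical inner products t. *)
definition nodes :: "real set" where
  "nodes = {2 - sqrt (3 / 2), 2, 2 + sqrt (3 / 2)}"

lemma nodes_bounds: "nodes \<subseteq> {0<..<4}" "card nodes = 3"
proof -
  define b :: real where "b = sqrt (3 / 2)"
  have "b < 2" "b > 0" unfolding b_def by (rule real_less_lsqrt) auto
  then show "nodes \<subseteq> {0<..<4}" "card nodes = 3"
    by (auto simp: nodes_def simp flip: b_def)
qed

lemma in_nodes_iff: "2 - 2 * t \<in> nodes \<longleftrightarrow> critical_inner t"
proof -
  have "2 * t \<in> {sqrt (3 / 2), - sqrt (3 / 2)} \<longleftrightarrow> \<bar>2 * t\<bar> = \<bar>sqrt (3 / 2)\<bar>"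
    by (auto simp: abs_eq_iff)
  also have "\<dots> \<longleftrightarrow> (2 * t)\<^sup>2 = (sqrt (3 / 2))\<^sup>2" by (metis power2_abs power2_eq_iff_nonneg abs_ge_zero)
  also have "\<dots> \<longleftrightarrow> t\<^sup>2 = 3 / 8" by (auto simp: power_mult_distrib)
  finally show ?thesis by (auto simp: nodes_def critical_inner_def)
qed

section \<open>The polynomial minorant of the potential function\<close>

locale convex_potential =
  fixes f :: "real \<Rightarrow> ereal"
  assumes not_MInf: "t \<in> {0..4} \<Longrightarrow> f t \<noteq> -\<infinity>"
    and not_PInf: "t \<in> {0<..4} \<Longrightarrow> f t \<noteq> \<infinity>"
    and cont: "continuous_on {0<..4} f"
    and lim0: "(f \<longlongrightarrow> f 0) (at_right 0)"
    and diff: "times_differentiable_on 4 (finite_part f) {0<..<4}"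
    and conv: "convex_on {0<..<4} ((deriv ^^ 4) (finite_part f))"
begin

lemma ereal_finite_part: "t \<in> {0<..4} \<Longrightarrow> ereal (finite_part f t) = f t"
  using not_MInf[of t] not_PInf[of t] by (intro ereal_real') auto

lemma deriv_chain:
  assumes "k < 4" "s \<in> {0<..<4}"
  shows "((deriv ^^ k) (finite_part f) has_real_derivative (deriv ^^ Suc k) (finite_part f) s) (at s)"
  using diff assms by (simp add: times_differentiable_on_def DERIV_deriv_iff_real_differentiable)

text \<open>Value and slope at three nodes are six conditions, matching degree 5, the strength of
  the designs. Strictness is claimed only inside the open interval, because the passage to the limit
  at 0 and 4 preserves just the weak inequality.\<close>

lemma Hermite_minorant:
  obtains P where "degree P \<le> 5" "\<And>t. t \<in> {0..4} \<Longrightarrow> ereal (poly P t) \<le> f t"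
    "\<And>t. t \<in> nodes \<Longrightarrow> f t = ereal (poly P t)"
    "\<And>t. strictly_convex_on {0<..<4} ((deriv ^^ 4) (finite_part f)) \<Longrightarrow> t \<in> {0<..<4} - nodes \<Longrightarrow>
       ereal (poly P t) < f t"
proof -
  let ?D = "\<lambda>k. (deriv ^^ k) (finite_part f)"
  have "finite nodes" by (simp add: nodes_def)
  from Hermite_interpolation_exists[OF this, of "?D 0" "?D 1"]
  obtain P where "P = 0 \<or> degree P < 2 * card nodes"
    and P: "\<And>z. z \<in> nodes \<Longrightarrow> poly P z = ?D 0 z" "\<And>z. z \<in> nodes \<Longrightarrow> poly (pderiv P) z = ?D 1 z"
    by metis
  then have deg: "degree P \<le> 5" using nodes_bounds(2) by auto
  note H = Hermite_lower_bound[of 0 4 ?D, OF deriv_chain nodes_bounds deg P]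
  have le: "ereal (poly P t) \<le> f t" if "t \<in> {0<..<4}" for t
  proof -
    have "ereal (poly P t) \<le> ereal (finite_part f t)" using H(1)[OF _ _ _ _ that conv] by simp
    also have "\<dots> = f t" using that by (intro ereal_finite_part) auto
    finally show ?thesis .
  qed
  have tends: "((\<lambda>s. ereal (poly P s)) \<longlongrightarrow> ereal (poly P t)) (at t within S)" for t S
    by (intro tendsto_ereal isCont_tendsto_compose[OF poly_isCont] tendsto_ident_at)
  \<comment> \<open>The bound passes to the endpoints by limits in \<open>ereal\<close>, so that
    \<open>f 0 = \<infinity>\<close> is covered as well.\<close>
  have le0: "ereal (poly P 0) \<le> f 0"
  proof (rule tendsto_le[OF _ lim0 tends])
    show "\<forall>\<^sub>F s in at_right 0. ereal (poly P s) \<le> f s"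
      by (rule eventually_mono[OF eventually_at_right_real[of 0 4] le]) auto
  qed simp
  have le4: "ereal (poly P 4) \<le> f 4"
  proof (rule tendsto_le[OF _ _ tends])
    have "(f \<longlongrightarrow> f 4) (at 4 within {0<..4})" using cont by (auto simp: continuous_on_def)
    moreover have "at 4 within {0<..4} = at_left (4::real)"
      by (rule at_within_nhd[of _ "{0<..}"]) auto
    ultimately show "(f \<longlongrightarrow> f 4) (at_left 4)" by simp
    show "\<forall>\<^sub>F s in at_left 4. ereal (poly P s) \<le> f s"
      by (rule eventually_mono[OF eventually_at_left_real[of 0 4] le]) auto
  qed simp
  show ?thesis
  proof (rule that[OF deg])
    show "ereal (poly P t) \<le> f t" if "t \<in> {0..4}" for t
      using that le[of t] le0 le4 by (cases "t = 0 \<or> t = 4") auto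
    show "f t = ereal (poly P t)" if "t \<in> nodes" for t
      using P(1)[OF that] ereal_finite_part[of t] nodes_bounds(1) that by auto
    show "ereal (poly P t) < f t"
      if "strictly_convex_on {0<..<4} (?D 4)" "t \<in> {0<..<4} - nodes" for t
    proof -
      have "ereal (poly P t) < ereal (finite_part f t)" using H(2)[OF _ _ _ _ _ that(1), of t] that(2) by simp
      also have "\<dots> = f t" using that(2) by (intro ereal_finite_part) auto
      finally show ?thesis .
    qed
  qed
qed

end

text \<open>A finite total rules out the value \<infinity>, and the lower bound \<open>h\<close>
  rules out -\<infinity>. The claim then concerns nonnegative real differences with sum
  zero.\<close>

lemma sum_ereal_eq_imp_eq:
  fixes g :: "'a \<Rightarrow> ereal" and h :: "'a \<Rightarrow> real"
  assumes "finite A" and le: "\<And>x. x \<in> A \<Longrightarrow> ereal (h x) \<le> g x"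
    and eq: "sum g A = ereal (sum h A)" and "x \<in> A"
  shows "g x = ereal (h x)"
proof -
  have "sum g A \<noteq> \<infinity>" using eq by simp
  then have "g z \<noteq> \<infinity>" if "z \<in> A" for z
    using assms(1) that by (auto simp: sum_Pinfty)
  then have g: "g z = ereal (real_of_ereal (g z))" if "z \<in> A" for z
    using le[OF that] that by (cases "g z") auto
  then have "sum g A = (\<Sum>z\<in>A. ereal (real_of_ereal (g z)))"
    by (rule sum.cong[OF refl])
  also have "\<dots> = ereal (\<Sum>z\<in>A. real_of_ereal (g z))" by simp
  finally have "(\<Sum>z\<in>A. real_of_ereal (g z)) = sum h A" using eq by simp
  then have "(\<Sum>z\<in>A. real_of_ereal (g z) - h z) = 0" by (simp add: sum_subtractf)
  moreover have "real_of_ereal (g z) - h z \<ge> 0" if "z \<in> A" for z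
    using le[OF that] g[OF that] by (metis diff_ge_0_iff_ge ereal_less_eq(3))
  ultimately have "real_of_ereal (g x) - h x = 0"
    using assms(1) \<open>x \<in> A\<close> by (subst (asm) sum_nonneg_eq_0_iff) auto
  then show ?thesis by (subst g[OF \<open>x \<in> A\<close>]) simp
qed

section \<open>Minima of the potential of a design\<close>

locale design_potential = antipodal_design + convex_potential
begin

lemma potential_eq: "x \<in> S5 \<Longrightarrow> potential f \<omega> x = (\<Sum>y\<in>\<omega>. f (2 - 2 * (x \<bullet> y)))"
  unfolding potential_def using sphere by (intro sum.cong) (auto simp: sphere_dist_inner)

lemma inner_range:
  assumes "x \<in> S5" "y \<in> \<omega>"
  shows "2 - 2 * (x \<bullet> y) \<in> {0..4}"
  using sphere_dist_inner(2)[of x y] assms sphere by auto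

lemma critical_imp_abs_min:
  assumes x0: "x0 \<in> S5" "\<And>y. y \<in> \<omega> \<Longrightarrow> critical_inner (x0 \<bullet> y)"
  shows "x0 \<in> abs_min_points (potential f \<omega>)"
proof -
  obtain P where P: "degree P \<le> 5" "\<And>t. t \<in> {0..4} \<Longrightarrow> ereal (poly P t) \<le> f t"
    "\<And>t. t \<in> nodes \<Longrightarrow> f t = ereal (poly P t)"
    by (rule Hermite_minorant) blast
  have "potential f \<omega> x0 \<le> potential f \<omega> x" if x: "x \<in> S5" for x
  proof -
    have "potential f \<omega> x0 = ereal (\<Sum>y\<in>\<omega>. poly P (2 - 2 * (x0 \<bullet> y)))"
      using x0 P(3) by (simp add: potential_eq in_nodes_iff flip: sum_ereal)
    also have "\<dots> = (\<Sum>y\<in>\<omega>. ereal (poly P (2 - 2 * (x \<bullet> y))))"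
      using sum_poly_eq[OF x0(1) x P(1)] by simp
    also have "\<dots> \<le> potential f \<omega> x"
      unfolding potential_eq[OF x] by (intro sum_mono P(2) inner_range x)
    finally show ?thesis .
  qed
  then show ?thesis using x0(1) by (simp add: abs_min_points_def)
qed

text \<open>The critical point \<open>x0\<close> shows that the minimum equals the constant sum of
  the minorant. A minimizer therefore meets the minorant in every single term.\<close>

lemma abs_min_imp_critical:
  assumes strict: "strictly_convex_on {0<..<4} ((deriv ^^ 4) (finite_part f))"
    and x0: "x0 \<in> S5" "\<And>y. y \<in> \<omega> \<Longrightarrow> critical_inner (x0 \<bullet> y)"
    and x: "x \<in> abs_min_points (potential f \<omega>)" and y: "y \<in> \<omega>"
  shows "critical_inner (x \<bullet> y)"
proof -
  obtain P where P: "degree P \<le> 5" "\<And>t. t \<in> {0..4} \<Longrightarrow> ereal (poly P t) \<le> f t"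
    "\<And>t. t \<in> nodes \<Longrightarrow> f t = ereal (poly P t)"
    "\<And>t. t \<in> {0<..<4} - nodes \<Longrightarrow> ereal (poly P t) < f t"
    by (rule Hermite_minorant) (use strict in blast)
  have xS: "x \<in> S5" using x by (simp add: abs_min_points_def)
  have "potential f \<omega> x = potential f \<omega> x0"
    using x x0 critical_imp_abs_min[OF x0] by (auto simp: abs_min_points_def intro: antisym)
  also have "\<dots> = ereal (\<Sum>y\<in>\<omega>. poly P (2 - 2 * (x0 \<bullet> y)))"
    using x0 P(3) by (simp add: potential_eq in_nodes_iff flip: sum_ereal)
  finally have eq: "(\<Sum>y\<in>\<omega>. f (2 - 2 * (x \<bullet> y))) = ereal (\<Sum>y\<in>\<omega>. poly P (2 - 2 * (x \<bullet> y)))"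
    unfolding potential_eq[OF xS] sum_poly_eq[OF x0(1) xS P(1)] .
  have "critical_inner (x \<bullet> z) \<or> \<bar>x \<bullet> z\<bar> = 1" if z: "z \<in> \<omega>" for z
  proof -
    have "f (2 - 2 * (x \<bullet> z)) = ereal (poly P (2 - 2 * (x \<bullet> z)))"
      by (rule sum_ereal_eq_imp_eq[OF finite _ eq z]) (intro P(2) inner_range xS)
    \<comment> \<open>Strictness leaves only the nodes and the endpoints 0 and 4, that is inner
      products 1 and -1, which the moments exclude afterwards.\<close>
    then have "2 - 2 * (x \<bullet> z) \<notin> {0<..<4} - nodes" using P(4)[of "2 - 2 * (x \<bullet> z)"] by auto
    then show ?thesis using inner_range[OF xS z] by (auto simp: in_nodes_iff)
  qed
  then show ?thesis using critical_inner_if_extremal[OF xS _ y] by blast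
qed

end

subsection \<open>The two configurations in integer coordinates\<close>

lemma exhaust_6: "(i::6) = 1 \<or> i = 2 \<or> i = 3 \<or> i = 4 \<or> i = 5 \<or> i = 6"
proof (induction i)
  case (of_int z)
  \<comment> \<open>The representatives run from 0 to 5, and the residue 0 is the numeral
    \<open>6\<close>.\<close>
  then have "z = 0 \<or> z = 1 \<or> z = 2 \<or> z = 3 \<or> z = 4 \<or> z = 5" by fastforce
  then show ?case by auto
qed

lemma UNIV_6: "UNIV = {1::6, 2, 3, 4, 5, 6}"
  using exhaust_6 by auto

lemma forall_6: "(\<forall>i::6. P i) \<longleftrightarrow> P 1 \<and> P 2 \<and> P 3 \<and> P 4 \<and> P 5 \<and> P 6"
  by (metis exhaust_6)

lemma exists_6: "(\<exists>i::6. P i) \<longleftrightarrow> P 1 \<or> P 2 \<or> P 3 \<or> P 4 \<or> P 5 \<or> P 6"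
  by (metis exhaust_6)

lemma sum_6: "sum g (UNIV::6 set) = g 1 + g 2 + g 3 + g 4 + g 5 + g 6"
  unfolding UNIV_6 by (simp add: ac_simps)

lemma card_6: "card {i::6. P i} = of_bool (P 1) + of_bool (P 2) + of_bool (P 3) +
    of_bool (P 4) + of_bool (P 5) + of_bool (P 6)"
proof -
  have "card {i::6. P i} = (\<Sum>i\<in>UNIV. of_bool (P i))" by simp
  then show ?thesis unfolding sum_6 .
qed

section \<open>Scaled integer vectors and antipodal sets given by lists\<close>

type_synonym int6 = "int \<times> int \<times> int \<times> int \<times> int \<times> int"

fun neg6 :: "int6 \<Rightarrow> int6" where
  "neg6 (a, b, c, d, e, h) = (- a, - b, - c, - d, - e, - h)"

fun dot6 :: "int6 \<Rightarrow> real \<Rightarrow> real \<Rightarrow> real \<Rightarrow> real \<Rightarrow> real \<Rightarrow> real \<Rightarrow> real" where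
  "dot6 (a, b, c, d, e, h) x1 x2 x3 x4 x5 x6 =
     of_int a * x1 + of_int b * x2 + of_int c * x3 + of_int d * x4 + of_int e * x5 + of_int h * x6"

fun idot6 :: "int6 \<Rightarrow> int6 \<Rightarrow> int" where
  "idot6 (a, b, c, d, e, h) (a', b', c', d', e', h') =
     a * a' + b * b' + c * c' + d * d' + e * e' + h * h'"

text \<open>One scale for the first five coordinates and another for the last absorb all
  irrationalities, leaving integer lists on which finite checks can be evaluated.\<close>

definition vec6 :: "real \<Rightarrow> real \<Rightarrow> int6 \<Rightarrow> real ^ 6" where
  "vec6 r s l = (case l of (a, b, c, d, e, h) \<Rightarrow>
     \<chi> i. if i = 1 then r * a else if i = 2 then r * b else if i = 3 then r * c
       else if i = 4 then r * d else if i = 5 then r * e else s * h)"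

lemma vec6_nth [simp]:
  "vec6 r s (a, b, c, d, e, h) $ 1 = r * a"
  "vec6 r s (a, b, c, d, e, h) $ 2 = r * b"
  "vec6 r s (a, b, c, d, e, h) $ 3 = r * c"
  "vec6 r s (a, b, c, d, e, h) $ 4 = r * d"
  "vec6 r s (a, b, c, d, e, h) $ 5 = r * e"
  "vec6 r s (a, b, c, d, e, h) $ 6 = s * h"
  by (simp_all add: vec6_def)

lemma inner_6: "x \<bullet> y = x $ 1 * y $ 1 + x $ 2 * y $ 2 + x $ 3 * y $ 3 + x $ 4 * y $ 4 +
    x $ 5 * y $ 5 + x $ 6 * y $ 6" for x y :: "real ^ 6"
  by (simp add: inner_vec_def sum_6)

lemma sphere_6: "x \<in> S5 \<longleftrightarrow> (x $ 1)\<^sup>2 + (x $ 2)\<^sup>2 + (x $ 3)\<^sup>2 + (x $ 4)\<^sup>2 + (x $ 5)\<^sup>2 + (x $ 6)\<^sup>2 = 1"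
  by (simp add: norm_eq_1 inner_6 power2_eq_square)

lemma inner_vec6: "x \<bullet> vec6 r s l =
    dot6 l (r * x $ 1) (r * x $ 2) (r * x $ 3) (r * x $ 4) (r * x $ 5) (s * x $ 6)"
  by (cases l) (simp add: inner_6 algebra_simps)

lemma vec6_neg6: "vec6 r s (neg6 l) = - vec6 r s l"
  by (cases l) (simp add: vec_eq_iff forall_6)

lemma inj_vec6: "r \<noteq> 0 \<Longrightarrow> s \<noteq> 0 \<Longrightarrow> inj (vec6 r s)"
  by (auto simp: inj_def vec_eq_iff forall_6)

definition config :: "real \<Rightarrow> real \<Rightarrow> int6 list \<Rightarrow> (real ^ 6) set" where
  "config r s L = vec6 r s ` (set L \<union> neg6 ` set L)"

lemma config_eq: "config r s L = vec6 r s ` set L \<union> uminus ` vec6 r s ` set L"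
  by (simp add: config_def image_Un image_image vec6_neg6)

lemma uminus_config: "y \<in> config r s L \<Longrightarrow> - y \<in> config r s L"
proof -
  have "neg6 (neg6 l) = l" for l by (cases l) simp
  then have "uminus ` config r s L = config r s L"
    by (simp add: config_def image_image image_Un Un_commute flip: vec6_neg6)
  then show "y \<in> config r s L \<Longrightarrow> - y \<in> config r s L" by blast
qed

text \<open>The arguments \<open>R\<close> and \<open>S\<close> stand for the squared scales, which
  are rational for both configurations.\<close>

fun qnorm6 :: "real \<Rightarrow> real \<Rightarrow> int6 \<Rightarrow> real" where
  "qnorm6 R S (a, b, c, d, e, h) = R * of_int (a\<^sup>2 + b\<^sup>2 + c\<^sup>2 + d\<^sup>2 + e\<^sup>2) + S * of_int (h\<^sup>2)"

lemma vec6_sphere: "vec6 r s l \<in> S5 \<longleftrightarrow> qnorm6 (r\<^sup>2) (s\<^sup>2) l = 1"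
  unfolding sphere_6 by (cases l) (simp add: power_mult_distrib distrib_left)

lemma sum_config:
  assumes "r \<noteq> 0" "s \<noteq> 0" "distinct (L @ map neg6 L)"
  shows "(\<Sum>y\<in>config r s L. F y) = (\<Sum>l\<leftarrow>L. F (vec6 r s l) + F (- vec6 r s l))"
proof -
  have "(\<Sum>y\<in>config r s L. F y) = (\<Sum>l\<in>set (L @ map neg6 L). F (vec6 r s l))"
    unfolding config_def using inj_vec6[OF assms(1,2)]
    by (subst sum.reindex) (auto intro: inj_on_subset)
  also have "\<dots> = (\<Sum>l\<leftarrow>L @ map neg6 L. F (vec6 r s l))"
    by (rule sum.distinct_set_conv_list[OF assms(3)])
  also have "\<dots> = (\<Sum>l\<leftarrow>L. F (vec6 r s l) + F (- vec6 r s l))"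
    by (simp add: sum_list_addf comp_def vec6_neg6)
  finally show ?thesis .
qed

lemma card_config:
  assumes "r \<noteq> 0" "s \<noteq> 0" "distinct (L @ map neg6 L)"
  shows "card (config r s L) = 2 * length L"
  using sum_config[OF assms, of "\<lambda>_. 1::nat"] by (simp add: sum_list_triv)

text \<open>The scales are moved from the configuration to the variable point, so that the moment
  conditions become polynomial identities in six free variables; on the sphere the bracket on the
  right becomes 1. Even powers agree on antipodal points, hence a sum over representatives
  suffices.\<close>

lemma antipodal_design_config:
  assumes rs: "r \<noteq> 0" "s \<noteq> 0" and dist: "distinct (L @ map neg6 L)"
    and norm: "\<And>l. l \<in> set L \<Longrightarrow> qnorm6 (r\<^sup>2) (s\<^sup>2) l = 1"
    and m2: "\<And>x1 x2 x3 x4 x5 x6. (\<Sum>l\<leftarrow>L. dot6 l x1 x2 x3 x4 x5 x6 ^ 2) =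
      length L / 6 * ((x1\<^sup>2 + x2\<^sup>2 + x3\<^sup>2 + x4\<^sup>2 + x5\<^sup>2) / r\<^sup>2 + x6\<^sup>2 / s\<^sup>2)"
    and m4: "\<And>x1 x2 x3 x4 x5 x6. (\<Sum>l\<leftarrow>L. dot6 l x1 x2 x3 x4 x5 x6 ^ 4) =
      length L / 16 * ((x1\<^sup>2 + x2\<^sup>2 + x3\<^sup>2 + x4\<^sup>2 + x5\<^sup>2) / r\<^sup>2 + x6\<^sup>2 / s\<^sup>2) ^ 2"
  shows "antipodal_design (config r s L)"
proof
  show "finite (config r s L)" by (simp add: config_def)
  have "vec6 r s l \<in> S5 \<and> vec6 r s (neg6 l) \<in> S5" if "l \<in> set L" for l
    using norm[OF that] vec6_sphere[of r s l] by (simp add: vec6_neg6)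
  then show "config r s L \<subseteq> S5" unfolding config_def by blast
  show "- y \<in> config r s L" if "y \<in> config r s L" for y using that by (rule uminus_config)
  fix x :: "real ^ 6" assume "x \<in> S5"
  then have *: "((r * x $ 1)\<^sup>2 + (r * x $ 2)\<^sup>2 + (r * x $ 3)\<^sup>2 + (r * x $ 4)\<^sup>2 + (r * x $ 5)\<^sup>2) / r\<^sup>2
      + (s * x $ 6)\<^sup>2 / s\<^sup>2 = 1"
    using rs unfolding sphere_6 by (simp add: power_mult_distrib flip: distrib_left)
  have even: "(\<Sum>y\<in>config r s L. (x \<bullet> y) ^ k) =
      2 * (\<Sum>l\<leftarrow>L. dot6 l (r * x $ 1) (r * x $ 2) (r * x $ 3) (r * x $ 4) (r * x $ 5) (s * x $ 6) ^ k)"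
    if "even k" for k
    using that unfolding sum_config[OF rs dist] by (simp add: inner_vec6 sum_list_const_mult)
  show "(\<Sum>y\<in>config r s L. (x \<bullet> y) ^ 2) = card (config r s L) / 6"
    unfolding even[OF even_numeral] m2 * card_config[OF rs dist] by simp
  show "(\<Sum>y\<in>config r s L. (x \<bullet> y) ^ 4) = card (config r s L) / 16"
    unfolding even[OF even_numeral] m4 * card_config[OF rs dist] by simp
qed

(* Integer coordinates of one point from each antipodal pair of the 54 and of the 72 points;
   see config54 and config72 for the scaling. *)
definition half54 :: "int6 list" where
  "half54 = (0, 0, 0, 0, 0, 4) #
    concat (map (\<lambda>p. [(p, 0, 0, 0, 0, -2), (0, p, 0, 0, 0, -2), (0, 0, p, 0, 0, -2),
      (0, 0, 0, p, 0, -2), (0, 0, 0, 0, p, -2)]) [2, -2]) @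
    [(a, b, c, d, a * b * c * d, 1). a \<leftarrow> [1, -1], b \<leftarrow> [1, -1], c \<leftarrow> [1, -1], d \<leftarrow> [1, -1]]"

definition half72 :: "int6 list" where
  "half72 = concat (map (\<lambda>p. [(2, p, 0, 0, 0, 0), (2, 0, p, 0, 0, 0), (2, 0, 0, p, 0, 0),
      (2, 0, 0, 0, p, 0), (0, 2, p, 0, 0, 0), (0, 2, 0, p, 0, 0), (0, 2, 0, 0, p, 0),
      (0, 0, 2, p, 0, 0), (0, 0, 2, 0, p, 0), (0, 0, 0, 2, p, 0)]) [2, -2]) @
    [(a, b, c, d, - (a * b * c * d), 1). a \<leftarrow> [1, -1], b \<leftarrow> [1, -1], c \<leftarrow> [1, -1], d \<leftarrow> [1, -1]]"

section \<open>Distinctness, inner products and moments of the two lists\<close>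

lemma distinct_half54: "distinct (half54 @ map neg6 half54)"
  by (simp add: half54_def)

lemma distinct_half72: "distinct (half72 @ map neg6 half72)"
  by (simp add: half72_def)

text \<open>Evaluation of all \<open>27 * 36\<close> products. The value 4 corresponds to
  \<open>sqrt 6 / 4\<close> after scaling.\<close>

lemma idot6_half54_half72:
  assumes "l \<in> set half54" "m \<in> set half72"
  shows "idot6 l m \<in> {0, 4, -4}"
proof -
  have "\<forall>l\<in>set half54. \<forall>m\<in>set half72. idot6 l m \<in> {0, 4, -4}"
    by code_simp
  then show ?thesis using assms by blast
qed

text \<open>In this and the next three identities the denominators are the squared scales, and the
  leading factor is the length of the list over 6 or 16. Unfolding the list leaves an identity of
  polynomials.\<close>

lemma half54_moment2: "(\<Sum>l\<leftarrow>half54. dot6 l x1 x2 x3 x4 x5 x6 ^ 2) =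
   27 / 6 * ((x1\<^sup>2 + x2\<^sup>2 + x3\<^sup>2 + x4\<^sup>2 + x5\<^sup>2) / (3 / 16) + x6\<^sup>2 / (1 / 16))"
  by (simp add: half54_def) algebra

lemma half72_moment2: "(\<Sum>l\<leftarrow>half72. dot6 l x1 x2 x3 x4 x5 x6 ^ 2) =
   36 / 6 * ((x1\<^sup>2 + x2\<^sup>2 + x3\<^sup>2 + x4\<^sup>2 + x5\<^sup>2) / (1 / 8) + x6\<^sup>2 / (3 / 8))"
  by (simp add: half72_def) algebra

lemma half54_moment4: "(\<Sum>l\<leftarrow>half54. dot6 l x1 x2 x3 x4 x5 x6 ^ 4) =
   27 / 16 * ((x1\<^sup>2 + x2\<^sup>2 + x3\<^sup>2 + x4\<^sup>2 + x5\<^sup>2) / (3 / 16) + x6\<^sup>2 / (1 / 16)) ^ 2"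
  by (simp add: half54_def) algebra

lemma half72_moment4: "(\<Sum>l\<leftarrow>half72. dot6 l x1 x2 x3 x4 x5 x6 ^ 4) =
   36 / 16 * ((x1\<^sup>2 + x2\<^sup>2 + x3\<^sup>2 + x4\<^sup>2 + x5\<^sup>2) / (1 / 8) + x6\<^sup>2 / (3 / 8)) ^ 2"
  by (simp add: half72_def) algebra

lemma critical_inner_minus [simp]: "critical_inner (- t) \<longleftrightarrow> critical_inner t"
  by (simp add: critical_inner_def)

lemma critical_inner_scaled: "critical_inner (sqrt 3 / (8 * sqrt 2) * t) \<longleftrightarrow> t \<in> {0, 4, -4}"
proof -
  have "(sqrt 3 / (8 * sqrt 2) * t)\<^sup>2 = 3 / 8 \<longleftrightarrow> t\<^sup>2 = 4\<^sup>2"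
    by (simp add: power_mult_distrib power_divide)
  also have "\<dots> \<longleftrightarrow> t = 4 \<or> t = - 4" by (rule power2_eq_iff)
  finally show ?thesis by (auto simp: critical_inner_def)
qed

abbreviation config54 :: "(real ^ 6) set" where
  "config54 \<equiv> config (sqrt 3 / 4) (1 / 4) half54"

abbreviation config72 :: "(real ^ 6) set" where
  "config72 \<equiv> config (1 / (2 * sqrt 2)) (sqrt 3 / (2 * sqrt 2)) half72"

text \<open>A single factor comes out because the two scales of one configuration times those of the
  other, first by first and last by last, give the same number.\<close>

lemma inner_vec6_half54_half72:
  "vec6 (sqrt 3 / 4) (1 / 4) l \<bullet> vec6 (1 / (2 * sqrt 2)) (sqrt 3 / (2 * sqrt 2)) m =
     sqrt 3 / (8 * sqrt 2) * idot6 l m"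
  by (cases l; cases m) (simp add: inner_6 field_simps)

lemma critical_inner_config:
  assumes "x \<in> config54" "y \<in> config72"
  shows "critical_inner (x \<bullet> y)"
proof -
  have "critical_inner (vec6 (sqrt 3 / 4) (1 / 4) l \<bullet> vec6 (1 / (2 * sqrt 2)) (sqrt 3 / (2 * sqrt 2)) m)"
    if "l \<in> set half54" "m \<in> set half72" for l m
    unfolding inner_vec6_half54_half72 critical_inner_scaled using idot6_half54_half72[OF that] by auto
  then show ?thesis using assms by (auto simp: config_eq)
qed

lemma antipodal_design_54: "antipodal_design config54"
proof (rule antipodal_design_config)
  have "\<forall>l\<in>set half54. qnorm6 (3 / 16) (1 / 16) l = 1" by (simp add: half54_def)
  then show "qnorm6 ((sqrt 3 / 4)\<^sup>2) ((1 / 4)\<^sup>2) l = 1" if "l \<in> set half54" for l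
    using that by (simp add: power_divide)
  have "length half54 = 27" by (simp add: half54_def)
  then show "(\<Sum>l\<leftarrow>half54. dot6 l x1 x2 x3 x4 x5 x6 ^ 2) = length half54 / 6 *
      ((x1\<^sup>2 + x2\<^sup>2 + x3\<^sup>2 + x4\<^sup>2 + x5\<^sup>2) / (sqrt 3 / 4)\<^sup>2 + x6\<^sup>2 / (1 / 4)\<^sup>2)"
    "(\<Sum>l\<leftarrow>half54. dot6 l x1 x2 x3 x4 x5 x6 ^ 4) = length half54 / 16 *
      ((x1\<^sup>2 + x2\<^sup>2 + x3\<^sup>2 + x4\<^sup>2 + x5\<^sup>2) / (sqrt 3 / 4)\<^sup>2 + x6\<^sup>2 / (1 / 4)\<^sup>2) ^ 2" for x1 x2 x3 x4 x5 x6
    using half54_moment2 half54_moment4 by (simp_all add: power_divide)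
qed (use distinct_half54 in auto)

lemma antipodal_design_72: "antipodal_design config72"
proof (rule antipodal_design_config)
  have "\<forall>l\<in>set half72. qnorm6 (1 / 8) (3 / 8) l = 1" by (simp add: half72_def)
  then show "qnorm6 ((1 / (2 * sqrt 2))\<^sup>2) ((sqrt 3 / (2 * sqrt 2))\<^sup>2) l = 1" if "l \<in> set half72" for l
    using that by (simp add: power_divide power_mult_distrib)
  have "length half72 = 36" by (simp add: half72_def)
  then show "(\<Sum>l\<leftarrow>half72. dot6 l x1 x2 x3 x4 x5 x6 ^ 2) = length half72 / 6 *
      ((x1\<^sup>2 + x2\<^sup>2 + x3\<^sup>2 + x4\<^sup>2 + x5\<^sup>2) / (1 / (2 * sqrt 2))\<^sup>2 + x6\<^sup>2 / (sqrt 3 / (2 * sqrt 2))\<^sup>2)"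
    "(\<Sum>l\<leftarrow>half72. dot6 l x1 x2 x3 x4 x5 x6 ^ 4) = length half72 / 16 *
      ((x1\<^sup>2 + x2\<^sup>2 + x3\<^sup>2 + x4\<^sup>2 + x5\<^sup>2) / (1 / (2 * sqrt 2))\<^sup>2 + x6\<^sup>2 / (sqrt 3 / (2 * sqrt 2))\<^sup>2) ^ 2" for x1 x2 x3 x4 x5 x6
    using half72_moment2 half72_moment4 by (simp_all add: power_divide power_mult_distrib)
qed (use distinct_half72 in auto)

section \<open>Recovering a point from its critical inner products\<close>

lemma vec6_exhaust:
  fixes x :: "real ^ 6"
  assumes "r \<noteq> 0" "s \<noteq> 0"
  obtains z1 z2 z3 z4 z5 z6 where "x $ 1 = r * z1" "x $ 2 = r * z2" "x $ 3 = r * z3"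
    "x $ 4 = r * z4" "x $ 5 = r * z5" "x $ 6 = s * z6"
  using that[of "x $ 1 / r" "x $ 2 / r" "x $ 3 / r" "x $ 4 / r" "x $ 5 / r" "x $ 6 / s"] assms by simp

definition mem_up_to_sign :: "int6 list \<Rightarrow> int6 \<Rightarrow> bool" where
  "mem_up_to_sign L l \<longleftrightarrow> l \<in> set L \<or> neg6 l \<in> set L"

lemma in_configI:
  assumes "mem_up_to_sign L (a, b, c, d, e, h)"
    "x $ 1 = r * of_int a" "x $ 2 = r * of_int b" "x $ 3 = r * of_int c"
    "x $ 4 = r * of_int d" "x $ 5 = r * of_int e" "x $ 6 = s * of_int h"
  shows "x \<in> config r s L"
proof -
  have "x = vec6 r s (a, b, c, d, e, h)" using assms(2-) by (simp add: vec_eq_iff forall_6)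
  moreover have "vec6 r s l = - vec6 r s (neg6 l)" for l by (simp add: vec6_neg6)
  ultimately show ?thesis using assms(1) unfolding config_eq mem_up_to_sign_def by blast
qed

lemma dot6_of_intD:
  assumes "dot6 l (of_int a) (of_int b) (of_int c) (of_int d) (of_int e) (of_int h) \<in> {0, 4, -4}"
  shows "idot6 l (a, b, c, d, e, h) \<in> {0, 4, -4}"
proof -
  have "dot6 l (of_int a) (of_int b) (of_int c) (of_int d) (of_int e) (of_int h) =
      of_int (idot6 l (a, b, c, d, e, h))" by (cases l) simp
  moreover have "(of_int k :: real) \<in> {0, 4, -4} \<longleftrightarrow> k \<in> {0, 4, -4}" for k
    using of_int_eq_iff[of k 0, where ?'a = real] of_int_eq_iff[of k 4, where ?'a = real]
      of_int_eq_iff[of k "-4", where ?'a = real] by simp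
  ultimately show ?thesis using assms by (simp only:)
qed

text \<open>Square sum 8 forces exactly two nonzero entries. In the list the first of them is 2,
  hence membership up to sign.\<close>

lemma half72_pairs: "\<forall>a\<in>{0, 2, -2 :: int}. \<forall>b\<in>{0, 2, -2 :: int}. \<forall>c\<in>{0, 2, -2 :: int}.
    \<forall>d\<in>{0, 2, -2 :: int}. \<forall>e\<in>{0, 2, -2 :: int}.
    a\<^sup>2 + b\<^sup>2 + c\<^sup>2 + d\<^sup>2 + e\<^sup>2 = 8 \<longrightarrow> mem_up_to_sign half72 (a, b, c, d, e, 0)"
  by code_simp

(* If the signs have the wrong parity, then (a, b, c, d, e, h) is up to sign the displayed point
   of the other list, and the product is 6 or - 6. *)
lemma half72_signs: "\<forall>a\<in>{1, -1 :: int}. \<forall>b\<in>{1, -1 :: int}. \<forall>c\<in>{1, -1 :: int}.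
    \<forall>d\<in>{1, -1 :: int}. \<forall>e\<in>{1, -1 :: int}. \<forall>h\<in>{1, -1 :: int}.
    (h * a, h * b, h * c, h * d, a * b * c * d, 1) \<in> set half54 \<and>
    (idot6 (h * a, h * b, h * c, h * d, a * b * c * d, 1) (a, b, c, d, e, h) \<in> {0, 4, -4} \<longrightarrow>
      mem_up_to_sign half72 (a, b, c, d, e, h))"
  by code_simp

text \<open>The product is \<open>5 * h - a * b * c * d * e\<close>: it equals \<open>4 * h\<close>
  when \<open>a * b * c * d * e = h\<close>, the parity wanted, and \<open>6 * h\<close>
  otherwise.\<close>

lemma half54_signs: "\<forall>a\<in>{1, -1 :: int}. \<forall>b\<in>{1, -1 :: int}. \<forall>c\<in>{1, -1 :: int}.
    \<forall>d\<in>{1, -1 :: int}. \<forall>e\<in>{1, -1 :: int}. \<forall>h\<in>{1, -1 :: int}.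
    (h * a, h * b, h * c, h * d, - (a * b * c * d), 1) \<in> set half72 \<and>
    (idot6 (h * a, h * b, h * c, h * d, - (a * b * c * d), 1) (a, b, c, d, e, h) \<in> {0, 4, -4} \<longrightarrow>
      mem_up_to_sign half54 (a, b, c, d, e, h))"
  by code_simp

text \<open>Here \<open>n\<close> is four times the number of nonzero entries. The cases 0 and 4
  give the poles and the axis points; the remaining ones violate the norm equation where the lemma
  is applied.\<close>

lemma half54_axes: "\<forall>a\<in>{0, 2, -2 :: int}. \<forall>b\<in>{0, 2, -2 :: int}. \<forall>c\<in>{0, 2, -2 :: int}.
    \<forall>d\<in>{0, 2, -2 :: int}. \<forall>e\<in>{0, 2, -2 :: int}.
    let n = a\<^sup>2 + b\<^sup>2 + c\<^sup>2 + d\<^sup>2 + e\<^sup>2 in n = 0 \<and> (\<forall>h\<in>{4, -4}. mem_up_to_sign half54 (a, b, c, d, e, h)) \<or>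
      n = 4 \<and> (\<forall>h\<in>{2, -2}. mem_up_to_sign half54 (a, b, c, d, e, h)) \<or> n \<ge> 6"
  by code_simp

text \<open>The pole restricts \<open>z6\<close> to 0, 1, -1, and the axis points then restrict the
  other coordinates to 0, 2, -2 if \<open>z6 = 0\<close> and to 1, -1 otherwise. The first case is
  finished by the norm, the second by one further product that detects the parity of the
  signs.\<close>

lemma half72_if_dot_half54:
  fixes z1 z2 z3 z4 z5 z6 :: real
  assumes dot: "\<forall>l\<in>set half54. dot6 l z1 z2 z3 z4 z5 z6 \<in> {0, 4, -4}"
    and norm: "z1\<^sup>2 + z2\<^sup>2 + z3\<^sup>2 + z4\<^sup>2 + z5\<^sup>2 + 3 * z6\<^sup>2 = 8"
  obtains a b c d e h where "mem_up_to_sign half72 (a, b, c, d, e, h)"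
    "z1 = of_int a" "z2 = of_int b" "z3 = of_int c" "z4 = of_int d" "z5 = of_int e" "z6 = of_int h"
proof -
  have z6: "z6 \<in> {0, 1, -1}"
    using bspec[OF dot, of "(0, 0, 0, 0, 0, 4)"] by (auto simp: half54_def)
  have two1: "2 * z1 - 2 * z6 \<in> {0, 4, -4} \<and> - 2 * z1 - 2 * z6 \<in> {0, 4, -4}"
    using bspec[OF dot, of "(2, 0, 0, 0, 0, -2)"] bspec[OF dot, of "(-2, 0, 0, 0, 0, -2)"]
    by (simp add: half54_def)
  have two2: "2 * z2 - 2 * z6 \<in> {0, 4, -4} \<and> - 2 * z2 - 2 * z6 \<in> {0, 4, -4}"
    using bspec[OF dot, of "(0, 2, 0, 0, 0, -2)"] bspec[OF dot, of "(0, -2, 0, 0, 0, -2)"]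
    by (simp add: half54_def)
  have two3: "2 * z3 - 2 * z6 \<in> {0, 4, -4} \<and> - 2 * z3 - 2 * z6 \<in> {0, 4, -4}"
    using bspec[OF dot, of "(0, 0, 2, 0, 0, -2)"] bspec[OF dot, of "(0, 0, -2, 0, 0, -2)"]
    by (simp add: half54_def)
  have two4: "2 * z4 - 2 * z6 \<in> {0, 4, -4} \<and> - 2 * z4 - 2 * z6 \<in> {0, 4, -4}"
    using bspec[OF dot, of "(0, 0, 0, 2, 0, -2)"] bspec[OF dot, of "(0, 0, 0, -2, 0, -2)"]
    by (simp add: half54_def)
  have two5: "2 * z5 - 2 * z6 \<in> {0, 4, -4} \<and> - 2 * z5 - 2 * z6 \<in> {0, 4, -4}"
    using bspec[OF dot, of "(0, 0, 0, 0, 2, -2)"] bspec[OF dot, of "(0, 0, 0, 0, -2, -2)"]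
    by (simp add: half54_def)
  have two: "2 * z - 2 * z6 \<in> {0, 4, -4} \<and> - 2 * z - 2 * z6 \<in> {0, 4, -4}"
    if "z \<in> {z1, z2, z3, z4, z5}" for z
    using that two1 two2 two3 two4 two5 by blast
  show thesis
  proof (cases "z6 = 0")
    case True
    have int: "\<exists>a::int. a \<in> {0, 2, -2} \<and> z = of_int a" if "z \<in> {z1, z2, z3, z4, z5}" for z
    proof -
      have "z = of_int 0 \<or> z = of_int 2 \<or> z = of_int (-2)" using two[OF that] True by auto
      then show ?thesis by blast
    qed
    obtain a :: int where a: "a \<in> {0, 2, -2}" "z1 = of_int a"
      using int[of z1] by blast
    obtain b :: int where b: "b \<in> {0, 2, -2}" "z2 = of_int b"
      using int[of z2] by blast
    obtain c :: int where c: "c \<in> {0, 2, -2}" "z3 = of_int c"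
      using int[of z3] by blast
    obtain d :: int where d: "d \<in> {0, 2, -2}" "z4 = of_int d"
      using int[of z4] by blast
    obtain e :: int where e: "e \<in> {0, 2, -2}" "z5 = of_int e"
      using int[of z5] by blast
    have "of_int (a\<^sup>2 + b\<^sup>2 + c\<^sup>2 + d\<^sup>2 + e\<^sup>2) = (of_int 8 :: real)"
      using norm True unfolding a(2) b(2) c(2) d(2) e(2) by simp
    then have "a\<^sup>2 + b\<^sup>2 + c\<^sup>2 + d\<^sup>2 + e\<^sup>2 = 8" by (simp only: of_int_eq_iff)
    then have "mem_up_to_sign half72 (a, b, c, d, e, 0)"
      using half72_pairs a(1) b(1) c(1) d(1) e(1) by blast
    then show ?thesis using that a(2) b(2) c(2) d(2) e(2) True by simp
  next
    case False
    have int: "\<exists>a::int. a \<in> {1, -1} \<and> z = of_int a" if "z \<in> {z1, z2, z3, z4, z5}" for z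
    proof -
      have "z = of_int 1 \<or> z = of_int (-1)" using two[OF that] z6 False by auto
      then show ?thesis by blast
    qed
    obtain a :: int where a: "a \<in> {1, -1}" "z1 = of_int a"
      using int[of z1] by blast
    obtain b :: int where b: "b \<in> {1, -1}" "z2 = of_int b"
      using int[of z2] by blast
    obtain c :: int where c: "c \<in> {1, -1}" "z3 = of_int c"
      using int[of z3] by blast
    obtain d :: int where d: "d \<in> {1, -1}" "z4 = of_int d"
      using int[of z4] by blast
    obtain e :: int where e: "e \<in> {1, -1}" "z5 = of_int e"
      using int[of z5] by blast
    have "z6 = of_int 1 \<or> z6 = of_int (-1)" using z6 False by auto
    then obtain h :: int where h: "h \<in> {1, -1}" "z6 = of_int h" by blast
    note ints = a(2) b(2) c(2) d(2) e(2) h(2)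
    have "(h * a, h * b, h * c, h * d, a * b * c * d, 1) \<in> set half54"
      using half72_signs a(1) b(1) c(1) d(1) e(1) h(1) by blast
    from bspec[OF dot this]
    have "idot6 (h * a, h * b, h * c, h * d, a * b * c * d, 1) (a, b, c, d, e, h) \<in> {0, 4, -4}"
      unfolding ints by (rule dot6_of_intD)
    then have "mem_up_to_sign half72 (a, b, c, d, e, h)"
      using half72_signs a(1) b(1) c(1) d(1) e(1) h(1) by blast
    then show ?thesis using that ints by blast
  qed
qed

text \<open>The points with entries in the first and one other place control the sums and
  differences of \<open>z1\<close> with \<open>z2\<close>, ..., \<open>z5\<close>, so these are
  integers of the same parity as \<open>z1\<close>. The norm then yields \<open>z6\<close> up to
  sign; in the odd case a last product fixes the parity of the signs.\<close>

lemma half54_if_dot_half72: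
  fixes z1 z2 z3 z4 z5 z6 :: real
  assumes dot: "\<forall>l\<in>set half72. dot6 l z1 z2 z3 z4 z5 z6 \<in> {0, 4, -4}"
    and norm: "3 * (z1\<^sup>2 + z2\<^sup>2 + z3\<^sup>2 + z4\<^sup>2 + z5\<^sup>2) + z6\<^sup>2 = 16"
  obtains a b c d e h where "mem_up_to_sign half54 (a, b, c, d, e, h)"
    "z1 = of_int a" "z2 = of_int b" "z3 = of_int c" "z4 = of_int d" "z5 = of_int e" "z6 = of_int h"
proof -
  have pair2: "z1 + z2 \<in> {0, 2, -2} \<and> z1 - z2 \<in> {0, 2, -2}"
    using bspec[OF dot, of "(2, 2, 0, 0, 0, 0)"] bspec[OF dot, of "(2, -2, 0, 0, 0, 0)"]
    by (simp add: half72_def) argo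
  have pair3: "z1 + z3 \<in> {0, 2, -2} \<and> z1 - z3 \<in> {0, 2, -2}"
    using bspec[OF dot, of "(2, 0, 2, 0, 0, 0)"] bspec[OF dot, of "(2, 0, -2, 0, 0, 0)"]
    by (simp add: half72_def) argo
  have pair4: "z1 + z4 \<in> {0, 2, -2} \<and> z1 - z4 \<in> {0, 2, -2}"
    using bspec[OF dot, of "(2, 0, 0, 2, 0, 0)"] bspec[OF dot, of "(2, 0, 0, -2, 0, 0)"]
    by (simp add: half72_def) argo
  have pair5: "z1 + z5 \<in> {0, 2, -2} \<and> z1 - z5 \<in> {0, 2, -2}"
    using bspec[OF dot, of "(2, 0, 0, 0, 2, 0)"] bspec[OF dot, of "(2, 0, 0, 0, -2, 0)"]
    by (simp add: half72_def) argo
  have pair: "z1 + z \<in> {0, 2, -2} \<and> z1 - z \<in> {0, 2, -2}" if "z \<in> {z2, z3, z4, z5}" for z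
    using that pair2 pair3 pair4 pair5 by blast
  \<comment> \<open>\<open>z1\<close> is half the sum of \<open>z1 + z2\<close> and
    \<open>z1 - z2\<close>.\<close>
  have first: "z1 \<in> {0, 1, -1, 2, -2}" using pair2 by auto
  show thesis
  proof (cases "z1 \<in> {1, -1}")
    case True
    have int: "\<exists>a::int. a \<in> {1, -1} \<and> z = of_int a" if "z \<in> {z1, z2, z3, z4, z5}" for z
    proof -
      have "z = of_int 1 \<or> z = of_int (-1)"
      proof (cases "z = z1")
        case False
        then show ?thesis using pair[of z] that True by auto
      qed (use True in simp)
      then show ?thesis by blast
    qed
    obtain a :: int where a: "a \<in> {1, -1}" "z1 = of_int a"
      using int[of z1] by blast
    obtain b :: int where b: "b \<in> {1, -1}" "z2 = of_int b"
      using int[of z2] by blast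
    obtain c :: int where c: "c \<in> {1, -1}" "z3 = of_int c"
      using int[of z3] by blast
    obtain d :: int where d: "d \<in> {1, -1}" "z4 = of_int d"
      using int[of z4] by blast
    obtain e :: int where e: "e \<in> {1, -1}" "z5 = of_int e"
      using int[of z5] by blast
    have sq: "a\<^sup>2 = 1" "b\<^sup>2 = 1" "c\<^sup>2 = 1" "d\<^sup>2 = 1" "e\<^sup>2 = 1"
      using a(1) b(1) c(1) d(1) e(1) by auto
    have "z6\<^sup>2 = 1"
      using norm unfolding a(2) b(2) c(2) d(2) e(2) of_int_power[symmetric] sq by simp
    then have "z6 = of_int 1 \<or> z6 = of_int (-1)" by (simp add: power2_eq_1_iff)
    then obtain h :: int where h: "h \<in> {1, -1}" "z6 = of_int h" by blast
    note ints = a(2) b(2) c(2) d(2) e(2) h(2)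
    have "(h * a, h * b, h * c, h * d, - (a * b * c * d), 1) \<in> set half72"
      using half54_signs a(1) b(1) c(1) d(1) e(1) h(1) by blast
    from bspec[OF dot this]
    have "idot6 (h * a, h * b, h * c, h * d, - (a * b * c * d), 1) (a, b, c, d, e, h) \<in> {0, 4, -4}"
      unfolding ints by (rule dot6_of_intD)
    then have "mem_up_to_sign half54 (a, b, c, d, e, h)"
      using half54_signs a(1) b(1) c(1) d(1) e(1) h(1) by blast
    then show ?thesis using that ints by blast
  next
    case False
    then have z1: "z1 = 0 \<or> z1 = 2 \<or> z1 = -2" using first by blast
    have int: "\<exists>a::int. a \<in> {0, 2, -2} \<and> z = of_int a" if "z \<in> {z1, z2, z3, z4, z5}" for z
    proof -
      have "z = of_int 0 \<or> z = of_int 2 \<or> z = of_int (-2)"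
      proof (cases "z = z1")
        case False
        then show ?thesis using pair[of z] that z1 by auto
      qed (use z1 in simp)
      then show ?thesis by blast
    qed
    obtain a :: int where a: "a \<in> {0, 2, -2}" "z1 = of_int a"
      using int[of z1] by blast
    obtain b :: int where b: "b \<in> {0, 2, -2}" "z2 = of_int b"
      using int[of z2] by blast
    obtain c :: int where c: "c \<in> {0, 2, -2}" "z3 = of_int c"
      using int[of z3] by blast
    obtain d :: int where d: "d \<in> {0, 2, -2}" "z4 = of_int d"
      using int[of z4] by blast
    obtain e :: int where e: "e \<in> {0, 2, -2}" "z5 = of_int e"
      using int[of z5] by blast
    define n where "n = a\<^sup>2 + b\<^sup>2 + c\<^sup>2 + d\<^sup>2 + e\<^sup>2"
    have sq: "3 * of_int n + z6\<^sup>2 = 16"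
      using norm unfolding a(2) b(2) c(2) d(2) e(2) n_def by simp
    \<comment> \<open>The bound excludes two or more nonzero entries, for which \<open>n\<close>
      would be at least 8.\<close>
    then have "3 * (of_int n :: real) \<le> 16" using zero_le_power2[of z6] by linarith
    then have "n < 6" by linarith
    then consider "n = 0" "\<And>h. h \<in> {4, -4} \<Longrightarrow> mem_up_to_sign half54 (a, b, c, d, e, h)"
      | "n = 4" "\<And>h. h \<in> {2, -2} \<Longrightarrow> mem_up_to_sign half54 (a, b, c, d, e, h)"
      using bspec[OF bspec[OF bspec[OF bspec[OF bspec[OF half54_axes a(1)] b(1)] c(1)] d(1)] e(1)]
      unfolding Let_def n_def[symmetric] not_less[symmetric] by blast
    then show ?thesis
    proof cases
      case 1
      then have "z6\<^sup>2 = 4\<^sup>2" using sq by simp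
      then have "z6 = of_int 4 \<or> z6 = of_int (-4)" unfolding power2_eq_iff by simp
      then obtain h :: int where "h \<in> {4, -4}" "z6 = of_int h" by blast
      then show ?thesis using 1(2) that a(2) b(2) c(2) d(2) e(2) by blast
    next
      case 2
      then have "z6\<^sup>2 = 2\<^sup>2" using sq by simp
      then have "z6 = of_int 2 \<or> z6 = of_int (-2)" unfolding power2_eq_iff by simp
      then obtain h :: int where "h \<in> {2, -2}" "z6 = of_int h" by blast
      then show ?thesis using 2(2) that a(2) b(2) c(2) d(2) e(2) by blast
    qed
  qed
qed

lemma in_config72_if_critical:
  assumes "x \<in> S5" "\<And>y. y \<in> config54 \<Longrightarrow> critical_inner (x \<bullet> y)"
  shows "x \<in> config72"
proof -
  obtain z1 z2 z3 z4 z5 z6 where z: "x $ 1 = 1 / (2 * sqrt 2) * z1" "x $ 2 = 1 / (2 * sqrt 2) * z2"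
    "x $ 3 = 1 / (2 * sqrt 2) * z3" "x $ 4 = 1 / (2 * sqrt 2) * z4" "x $ 5 = 1 / (2 * sqrt 2) * z5"
    "x $ 6 = sqrt 3 / (2 * sqrt 2) * z6"
    by (rule vec6_exhaust[of "1 / (2 * sqrt 2)" "sqrt 3 / (2 * sqrt 2)" x]) auto
  have norm: "z1\<^sup>2 + z2\<^sup>2 + z3\<^sup>2 + z4\<^sup>2 + z5\<^sup>2 + 3 * z6\<^sup>2 = 8"
    using assms(1) unfolding sphere_6 z by (simp add: power_mult_distrib power_divide)
  have dot: "x \<bullet> vec6 (sqrt 3 / 4) (1 / 4) l = sqrt 3 / (8 * sqrt 2) * dot6 l z1 z2 z3 z4 z5 z6" for l
    by (cases l) (simp add: inner_6 z field_simps)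
  have "\<forall>l\<in>set half54. dot6 l z1 z2 z3 z4 z5 z6 \<in> {0, 4, -4}"
    using assms(2) unfolding config_eq critical_inner_scaled[symmetric] dot[symmetric] by blast
  from half72_if_dot_half54[OF this norm]
  obtain a b c d e h where "mem_up_to_sign half72 (a, b, c, d, e, h)"
    and "z1 = of_int a" "z2 = of_int b" "z3 = of_int c" "z4 = of_int d" "z5 = of_int e" "z6 = of_int h" .
  then show ?thesis by (intro in_configI[of _ a b c d e h]) (simp_all add: z)
qed

lemma in_config54_if_critical:
  assumes "x \<in> S5" "\<And>y. y \<in> config72 \<Longrightarrow> critical_inner (x \<bullet> y)"
  shows "x \<in> config54"
proof -
  obtain z1 z2 z3 z4 z5 z6 where z: "x $ 1 = sqrt 3 / 4 * z1" "x $ 2 = sqrt 3 / 4 * z2"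
    "x $ 3 = sqrt 3 / 4 * z3" "x $ 4 = sqrt 3 / 4 * z4" "x $ 5 = sqrt 3 / 4 * z5" "x $ 6 = 1 / 4 * z6"
    by (rule vec6_exhaust[of "sqrt 3 / 4" "1 / 4" x]) auto
  have norm: "3 * (z1\<^sup>2 + z2\<^sup>2 + z3\<^sup>2 + z4\<^sup>2 + z5\<^sup>2) + z6\<^sup>2 = 16"
    using assms(1) unfolding sphere_6 z by (simp add: power_mult_distrib power_divide)
  have dot: "x \<bullet> vec6 (1 / (2 * sqrt 2)) (sqrt 3 / (2 * sqrt 2)) l =
      sqrt 3 / (8 * sqrt 2) * dot6 l z1 z2 z3 z4 z5 z6" for l
    by (cases l) (simp add: inner_6 z field_simps)
  have "\<forall>l\<in>set half72. dot6 l z1 z2 z3 z4 z5 z6 \<in> {0, 4, -4}"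
    using assms(2) unfolding config_eq critical_inner_scaled[symmetric] dot[symmetric] by blast
  from half54_if_dot_half72[OF this norm]
  obtain a b c d e h where "mem_up_to_sign half54 (a, b, c, d, e, h)"
    and "z1 = of_int a" "z2 = of_int b" "z3 = of_int c" "z4 = of_int d" "z5 = of_int e" "z6 = of_int h" .
  then show ?thesis by (intro in_configI[of _ a b c d e h]) (simp_all add: z)
qed

section \<open>Identification of the configurations with the integer lists\<close>

lemma abs_eq_scaled:
  assumes "\<bar>u\<bar> = r * real_of_int k"
  shows "\<exists>a. a \<in> {k, - k} \<and> u = r * real_of_int a"
proof (cases "u \<ge> 0")
  case True
  then show ?thesis using assms by (intro exI[of _ k]) simp
next
  case False
  then show ?thesis using assms by (intro exI[of _ "- k"]) simp
qed

text \<open>The fifth entry of a listed sign vector is minus the product of the first four and the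
  sixth is 1, so the number of minus signs is odd. Negating all six entries preserves this parity,
  which settles \<open>h = -1\<close>.\<close>

lemma half72_odd: "\<forall>a\<in>{1, -1 :: int}. \<forall>b\<in>{1, -1 :: int}. \<forall>c\<in>{1, -1 :: int}.
    \<forall>d\<in>{1, -1 :: int}. \<forall>e\<in>{1, -1 :: int}. \<forall>h\<in>{1, -1 :: int}.
    odd (of_bool (a < 0) + of_bool (b < 0) + of_bool (c < 0) + of_bool (d < 0) + of_bool (e < 0) + of_bool (h < 0) :: nat) \<longrightarrow>
      mem_up_to_sign half72 (a, b, c, d, e, h)"
  by code_simp

lemma half54_even: "\<forall>a\<in>{1, -1 :: int}. \<forall>b\<in>{1, -1 :: int}. \<forall>c\<in>{1, -1 :: int}.
    \<forall>d\<in>{1, -1 :: int}. \<forall>e\<in>{1, -1 :: int}.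
    even (of_bool (a < 0) + of_bool (b < 0) + of_bool (c < 0) + of_bool (d < 0) + of_bool (e < 0) :: nat) \<longrightarrow>
      mem_up_to_sign half54 (a, b, c, d, e, 1)"
  by code_simp

lemma scaled_neg_iff: "r > 0 \<Longrightarrow> r * real_of_int a < 0 \<longleftrightarrow> a < 0"
  by (simp add: mult_less_0_iff)

lemma omega72_eq: "omega72 = config72"
proof
  let ?r = "1 / (2 * sqrt 2)" and ?s = "sqrt 3 / (2 * sqrt 2)"
  have r: "1 / sqrt 2 = ?r * real_of_int 2" by simp
  have pos: "?r > 0" "?s > 0" by simp_all
  show "omega72 \<subseteq> config72"
  proof
    fix x assume "x \<in> omega72"
    then consider i j where "i \<noteq> 6" "j \<noteq> 6" "i \<noteq> j"
         "\<bar>x $ i\<bar> = 1 / sqrt 2" "\<bar>x $ j\<bar> = 1 / sqrt 2" "\<And>k. k \<noteq> i \<Longrightarrow> k \<noteq> j \<Longrightarrow> x $ k = 0"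
      | "\<And>i. i \<noteq> 6 \<Longrightarrow> \<bar>x $ i\<bar> = ?r" "\<bar>x $ 6\<bar> = ?s" "odd (card {i. x $ i < 0})"
      unfolding omega72_def by blast
    then show "x \<in> config72"
    proof cases
      case (1 i j)
      obtain \<sigma> where s: "\<sigma> \<in> {2, -2}" "x $ i = ?r * real_of_int \<sigma>"
        using abs_eq_scaled[OF 1(4)[unfolded r]] by blast
      obtain \<tau> where t: "\<tau> \<in> {2, -2}" "x $ j = ?r * real_of_int \<tau>"
        using abs_eq_scaled[OF 1(5)[unfolded r]] by blast
      \<comment> \<open>An integer function on all indices makes \<open>half72_pairs\<close>
        applicable without a case split over the positions \<open>i\<close> and
        \<open>j\<close>.\<close>
      define a where "a k = (if k = i then \<sigma> else if k = j then \<tau> else 0)" for k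
      have x: "x $ k = ?r * real_of_int (a k)" for k using s(2) t(2) 1(6)[of k] by (simp add: a_def)
      have a: "a k \<in> {0, 2, -2}" for k using s(1) t(1) by (simp add: a_def)
      have "(\<Sum>k\<in>UNIV. (a k)\<^sup>2) = (\<Sum>k\<in>{i, j}. (a k)\<^sup>2)"
        by (rule sum.mono_neutral_right) (auto simp: a_def)
      also have "\<dots> = 8" using 1(3) s(1) t(1) by (auto simp: a_def)
      finally have "(a 1)\<^sup>2 + (a 2)\<^sup>2 + (a 3)\<^sup>2 + (a 4)\<^sup>2 + (a 5)\<^sup>2 = 8"
        using 1(1,2) unfolding sum_6 by (simp add: a_def[of 6])
      then have "mem_up_to_sign half72 (a 1, a 2, a 3, a 4, a 5, 0)"
        using half72_pairs a by blast
      then show ?thesis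
        by (rule in_configI) (use x[of 1] x[of 2] x[of 3] x[of 4] x[of 5] 1(6)[of 6] 1(1,2) in auto)
    next
      case 2
      have "\<exists>a. a \<in> {1, -1} \<and> x $ i = ?r * real_of_int a" if "i \<noteq> 6" for i
        using abs_eq_scaled[of "x $ i" ?r 1] 2(1)[OF that] by simp
      then obtain a where a: "\<And>i. i \<noteq> 6 \<Longrightarrow> a i \<in> {1, -1}" "\<And>i. i \<noteq> 6 \<Longrightarrow> x $ i = ?r * real_of_int (a i)"
        by metis
      obtain h where h: "h \<in> {1, -1}" "x $ 6 = ?s * real_of_int h"
        using abs_eq_scaled[of "x $ 6" ?s 1] 2(2) by auto
      have x: "x $ 1 = ?r * real_of_int (a 1)" "x $ 2 = ?r * real_of_int (a 2)" "x $ 3 = ?r * real_of_int (a 3)"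
        "x $ 4 = ?r * real_of_int (a 4)" "x $ 5 = ?r * real_of_int (a 5)" "x $ 6 = ?s * real_of_int h"
        using a(2) h(2) by simp_all
      have "odd (of_bool (a 1 < 0) + of_bool (a 2 < 0) + of_bool (a 3 < 0) + of_bool (a 4 < 0) +
          of_bool (a 5 < 0) + of_bool (h < 0) :: nat)"
        using 2(3) unfolding card_6 x pos[THEN scaled_neg_iff] .
      then have "mem_up_to_sign half72 (a 1, a 2, a 3, a 4, a 5, h)"
        using bspec[OF bspec[OF bspec[OF bspec[OF bspec[OF bspec[OF half72_odd a(1)] a(1)] a(1)] a(1)] a(1)] h(1), of 1 2 3 4 5]
        by simp
      then show ?thesis using x by (rule in_configI)
    qed
  qed
  \<comment> \<open>For the converse each listed point is tested separately; quantifiers over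
    indices and the cardinality of the set of negative entries unfold to finite expressions.\<close>
  have "vec6 ?r ?s l \<in> omega72 \<and> - vec6 ?r ?s l \<in> omega72" if "l \<in> set half72" for l
    using that unfolding half72_def
    by (simp, elim disjE; simp add: omega72_def exists_6 forall_6 card_6
        divide_less_0_iff)
  then show "config72 \<subseteq> omega72" unfolding config_eq by blast
qed

text \<open>The vectors listed in \<open>half54\<close> represent \<open>omega27\<close> itself, so
  only \<open>omega27\<close> has to be compared and the antipodes follow.\<close>

lemma omega54_eq: "omega54 = config54"
proof
  let ?r = "sqrt 3 / 4" and ?s = "1 / 4 :: real"
  have r: "sqrt 3 / 2 = ?r * real_of_int 2" by simp
  have "omega27 \<subseteq> config54"
  proof
    fix x assume "x \<in> omega27"
    then consider "x = axis 6 1"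
      | i where "x $ 6 = - 1 / 2" "i \<noteq> 6" "\<bar>x $ i\<bar> = sqrt 3 / 2" "\<And>j. j \<noteq> 6 \<Longrightarrow> j \<noteq> i \<Longrightarrow> x $ j = 0"
      | "x $ 6 = 1 / 4" "\<And>i. i \<noteq> 6 \<Longrightarrow> \<bar>x $ i\<bar> = ?r" "even (card {i. i \<noteq> 6 \<and> x $ i < 0})"
      unfolding omega27_def by blast
    then show "x \<in> config54"
    proof cases
      case 1
      have "mem_up_to_sign half54 (0, 0, 0, 0, 0, 4)" by (simp add: mem_up_to_sign_def half54_def)
      then show ?thesis by (rule in_configI) (simp_all add: 1 axis_def)
    next
      case (2 i)
      obtain \<sigma> where st: "\<sigma> \<in> {2, -2}" "x $ i = ?r * real_of_int \<sigma>"
        using abs_eq_scaled[OF 2(3)[unfolded r]] by blast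
      define a where "a k = (if k = i then \<sigma> else 0)" for k
      have x: "x $ k = ?r * real_of_int (a k)" if "k \<noteq> 6" for k using st(2) 2(4)[OF that] by (simp add: a_def)
      have a: "a k \<in> {0, 2, -2}" for k using st(1) by (simp add: a_def)
      have "(\<Sum>k\<in>UNIV. (a k)\<^sup>2) = (\<Sum>k\<in>{i}. (a k)\<^sup>2)"
        by (rule sum.mono_neutral_right) (auto simp: a_def)
      also have "\<dots> = 4" using st(1) by (auto simp: a_def)
      finally have "(a 1)\<^sup>2 + (a 2)\<^sup>2 + (a 3)\<^sup>2 + (a 4)\<^sup>2 + (a 5)\<^sup>2 = 4"
        using 2(2) unfolding sum_6 by (simp add: a_def[of 6])
      then have "mem_up_to_sign half54 (a 1, a 2, a 3, a 4, a 5, -2)"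
        using bspec[OF bspec[OF bspec[OF bspec[OF bspec[OF half54_axes a] a] a] a] a, of 1 2 3 4 5]
        by (simp add: Let_def)
      then show ?thesis
        by (rule in_configI) (simp_all add: x 2(1))
    next
      case 3
      have "\<exists>a. a \<in> {1, -1} \<and> x $ i = ?r * real_of_int a" if "i \<noteq> 6" for i
        using abs_eq_scaled[of "x $ i" ?r 1] 3(2)[OF that] by simp
      then obtain a where a: "\<And>i. i \<noteq> 6 \<Longrightarrow> a i \<in> {1, -1}" "\<And>i. i \<noteq> 6 \<Longrightarrow> x $ i = ?r * real_of_int (a i)"
        by metis
      have x: "x $ 1 = ?r * real_of_int (a 1)" "x $ 2 = ?r * real_of_int (a 2)" "x $ 3 = ?r * real_of_int (a 3)"
        "x $ 4 = ?r * real_of_int (a 4)" "x $ 5 = ?r * real_of_int (a 5)" "x $ 6 = ?s * real_of_int 1"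
        using a(2) 3(1) by simp_all
      have "even (of_bool (a 1 < 0) + of_bool (a 2 < 0) + of_bool (a 3 < 0) + of_bool (a 4 < 0) +
          of_bool (a 5 < 0) :: nat)"
        using 3(3) unfolding card_6 x by (simp add: scaled_neg_iff)
      then have "mem_up_to_sign half54 (a 1, a 2, a 3, a 4, a 5, 1)"
        using bspec[OF bspec[OF bspec[OF bspec[OF bspec[OF half54_even a(1)] a(1)] a(1)] a(1)] a(1), of 1 2 3 4 5]
        by simp
      then show ?thesis using x by (rule in_configI)
    qed
  qed
  then show "omega54 \<subseteq> config54" unfolding omega54_def using uminus_config by blast
  have "vec6 ?r ?s l \<in> omega27" if "l \<in> set half54" for l
    using that unfolding half54_def
    by (simp, elim disjE; simp add: omega27_def exists_6 forall_6 card_6 axis_def vec_eq_iff)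
  then show "config54 \<subseteq> omega54" unfolding config_eq omega54_def by blast
qed

theorem theorem9p3:
  fixes f :: "real \<Rightarrow> ereal"
  assumes "\<And>t. t \<in> {0..4} \<Longrightarrow> f t \<noteq> -\<infinity>"
    and "\<And>t. t \<in> {0<..4} \<Longrightarrow> f t \<noteq> \<infinity>"
    and "continuous_on {0<..4} f"
    and "(f \<longlongrightarrow> f 0) (at_right 0)"
    and "times_differentiable_on 4 (finite_part f) {0<..<4}"
    and "convex_on {0<..<4} ((deriv ^^ 4) (finite_part f))"
  shows "omega72 \<subseteq> abs_min_points (potential f omega54)
    \<and> omega54 \<subseteq> abs_min_points (potential f omega72)
    \<and> (strictly_convex_on {0<..<4} ((deriv ^^ 4) (finite_part f)) \<longrightarrow>
         abs_min_points (potential f omega54) \<subseteq> omega72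
       \<and> abs_min_points (potential f omega72) \<subseteq> omega54)"
proof -
  interpret convex_potential f by standard (use assms in auto)
  interpret A: antipodal_design config54 by (rule antipodal_design_54)
  interpret B: antipodal_design config72 by (rule antipodal_design_72)
  interpret A: design_potential config54 f ..
  interpret B: design_potential config72 f ..
  \<comment> \<open>Nonemptiness supplies, for each potential, the critical point needed in the
    strict case: any point of the other configuration.\<close>
  have ne: "config54 \<noteq> {}" "config72 \<noteq> {}" by (simp_all add: config_def half54_def half72_def)
  have A: "x \<in> S5 \<and> (\<forall>y\<in>config54. critical_inner (x \<bullet> y))" if "x \<in> config72" for x
    using that B.sphere critical_inner_config by (auto simp: inner_commute)
  have B: "x \<in> S5 \<and> (\<forall>y\<in>config72. critical_inner (x \<bullet> y))" if "x \<in> config54" for x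
    using that A.sphere critical_inner_config by auto
  show ?thesis
    unfolding omega54_eq omega72_eq
  proof (intro conjI impI subsetI)
    show "x \<in> abs_min_points (potential f config54)" if "x \<in> config72" for x
      using A.critical_imp_abs_min A[OF that] by blast
    show "x \<in> abs_min_points (potential f config72)" if "x \<in> config54" for x
      using B.critical_imp_abs_min B[OF that] by blast
  next
    fix x assume strict: "strictly_convex_on {0<..<4} ((deriv ^^ 4) (finite_part f))"
      and x: "x \<in> abs_min_points (potential f config54)"
    obtain x0 where "x0 \<in> config72" using ne by blast
    then show "x \<in> config72"
      using A.abs_min_imp_critical[OF strict _ _ x] A x
      by (intro in_config72_if_critical) (auto simp: abs_min_points_def)
  next
    fix x assume strict: "strictly_convex_on {0<..<4} ((deriv ^^ 4) (finite_part f))"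
      and x: "x \<in> abs_min_points (potential f config72)"
    obtain x0 where "x0 \<in> config54" using ne by blast
    then show "x \<in> config54"
      using B.abs_min_imp_critical[OF strict _ _ x] B x
      by (intro in_config54_if_critical) (auto simp: abs_min_points_def)
  qed
qed

end
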